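(* Let $U$ be a finite set, let $\mathcal{F}\subseteq 2^U$ be an intersecting 2/3-laminar family, and let $g:\mathcal{F}\rightarrow \mathbf{Z}$ be an intersecting 2/3-supermodular function. Let $k$ be a positive integer. Suppose that $\mathcal{L}=\{X\in \mathcal{F}\mid g(X)+D_{\mathcal{F}}(X)>k\}$ is a $g$-laminar family and that $\min\{|X|,k\}\geq g(X)$ holds for every $X\in \mathcal{F}$. Then there exists an assignment of colors $\pi:U\rightarrow [k]$ such that $$|\pi(X)|\geq g(X)$$ holds for every $X\in \mathcal{F}$.
   Context: $[k]=\{1,\ldots,k\}$, and for $\pi:U\rightarrow [k]$ and $X\subseteq U$, $\pi(X)=\{\pi(u)\mid u\in X\}$. A family $\mathcal{F}\subseteq 2^U$ is an intersecting 2/3-laminar family if for all distinct $X_1,X_2,X_3\in \mathcal{F}$ with $X_1\cap X_2\cap X_3\neq\emptyset$, there exist two distinct pairs $(i,j),(k,l)\in\{(1,2),(2,3),(3,1)\}$ such that $X_i\cup X_j,\ X_i\cap X_j,\ X_k\cup X_l,\ X_k\cap X_l\in\mathcal{F}$ (here $k,l$ are indices). A function $g:\mathcal{F}\rightarrow\mathbf{R}$ is intersecting 2/3-supermodular if $\mathcal{F}$ is an intersecting 2/3-laminar family and for all distinct $X_1,X_2,X_3\in\mathcal{F}$ with $X_1\cap X_2\cap X_3\neq\emptyset$, there exist two distinct pairs $(i,j),(k,l)\in\{(1,2),(2,3),(3,1)\}$ such that $X_i\cup X_j, X_i\cap X_j, X_k\cup X_l, X_k\cap X_l\in\mathcal{F}$,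 $g(X_i)+g(X_j)\leq g(X_i\cup X_j)+g(X_i\cap X_j)$, and $g(X_k)+g(X_l)\leq g(X_k\cup X_l)+g(X_k\cap X_l)$. For $g:\mathcal{F}\rightarrow\mathbf{R}$, a subfamily $\mathcal{L}\subseteq\mathcal{F}$ is a $g$-laminar family if for every pair $X,Y\in\mathcal{L}$ at least one of the following holds: (i) at least one of $X\setminus Y$, $Y\setminus X$, $X\cap Y$ is empty; (ii) $X\cup Y, X\cap Y\in\mathcal{F}$ and $g(X)+g(Y)\leq g(X\cup Y)+g(X\cap Y)$. For $X\in\mathcal{F}$, $D_{\mathcal{F}}(X)=\max\{|X\cap Y| \mid Y=\emptyset, \text{ or } Y\in\mathcal{F} \text{ with } X\not\subseteq Y \text{ and } Y\not\subseteq X\}$. *)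

theory Defs
  imports Main "HOL-Library.FuncSet"
begin

text \<open>
  Functions on a family are total functions on sets of which only the values on the family are
  used. The value type is left polymorphic, so that the notions apply to real-valued functions
  and, without coercions, to integer-valued ones.
\<close>

text \<open>
  A choice of two distinct index pairs among \<open>(1,2)\<close>, \<open>(2,3)\<close>, \<open>(3,1)\<close> is expressed as a choice of
  two distinct pairs of sets; this is the same because the three sets are pairwise distinct.
\<close>

definition intersecting_two_thirds_laminar :: "'a set set \<Rightarrow> bool" where
  "intersecting_two_thirds_laminar F \<longleftrightarrow>
     (\<forall>X\<^sub>1\<in>F. \<forall>X\<^sub>2\<in>F. \<forall>X\<^sub>3\<in>F.
        X\<^sub>1 \<noteq> X\<^sub>2 \<and> X\<^sub>2 \<noteq> X\<^sub>3 \<and> X\<^sub>3 \<noteq> X\<^sub>1 \<and> X\<^sub>1 \<inter> X\<^sub>2 \<inter> X\<^sub>3 \<noteq> {} \<longrightarrow>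
        (\<exists>(A, B) \<in> {(X\<^sub>1, X\<^sub>2), (X\<^sub>2, X\<^sub>3), (X\<^sub>3, X\<^sub>1)}.
         \<exists>(C, D) \<in> {(X\<^sub>1, X\<^sub>2), (X\<^sub>2, X\<^sub>3), (X\<^sub>3, X\<^sub>1)}.
           (A, B) \<noteq> (C, D) \<and>
           A \<union> B \<in> F \<and> A \<inter> B \<in> F \<and> C \<union> D \<in> F \<and> C \<inter> D \<in> F))"

definition intersecting_two_thirds_supermodular ::
    "'a set set \<Rightarrow> ('a set \<Rightarrow> 'b::linordered_idom) \<Rightarrow> bool" where
  "intersecting_two_thirds_supermodular F g \<longleftrightarrow>
     intersecting_two_thirds_laminar F \<and>
     (\<forall>X\<^sub>1\<in>F. \<forall>X\<^sub>2\<in>F. \<forall>X\<^sub>3\<in>F.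
        X\<^sub>1 \<noteq> X\<^sub>2 \<and> X\<^sub>2 \<noteq> X\<^sub>3 \<and> X\<^sub>3 \<noteq> X\<^sub>1 \<and> X\<^sub>1 \<inter> X\<^sub>2 \<inter> X\<^sub>3 \<noteq> {} \<longrightarrow>
        (\<exists>(A, B) \<in> {(X\<^sub>1, X\<^sub>2), (X\<^sub>2, X\<^sub>3), (X\<^sub>3, X\<^sub>1)}.
         \<exists>(C, D) \<in> {(X\<^sub>1, X\<^sub>2), (X\<^sub>2, X\<^sub>3), (X\<^sub>3, X\<^sub>1)}.
           (A, B) \<noteq> (C, D) \<and>
           A \<union> B \<in> F \<and> A \<inter> B \<in> F \<and> C \<union> D \<in> F \<and> C \<inter> D \<in> F \<and>
           g A + g B \<le> g (A \<union> B) + g (A \<inter> B) \<and>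
           g C + g D \<le> g (C \<union> D) + g (C \<inter> D)))"

definition g_laminar ::
    "'a set set \<Rightarrow> ('a set \<Rightarrow> 'b::linordered_idom) \<Rightarrow> 'a set set \<Rightarrow> bool" where
  "g_laminar F g L \<longleftrightarrow>
     L \<subseteq> F \<and>
     (\<forall>X\<in>L. \<forall>Y\<in>L.
        (X - Y = {} \<or> Y - X = {} \<or> X \<inter> Y = {}) \<or>
        (X \<union> Y \<in> F \<and> X \<inter> Y \<in> F \<and> g X + g Y \<le> g (X \<union> Y) + g (X \<inter> Y)))"

text \<open>
  The set below is nonempty because of \<open>Y = {}\<close>, and for finite \<open>X\<close> it is bounded by \<open>card X\<close>,
  so that its maximum exists.
\<close>

definition max_crossing :: "'a set set \<Rightarrow> 'a set \<Rightarrow> nat" where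
  "max_crossing F X =
     Max {card (X \<inter> Y) | Y. Y = {} \<or> (Y \<in> F \<and> \<not> X \<subseteq> Y \<and> \<not> Y \<subseteq> X)}"

end

theory Submission
  imports Defs "HOL-Combinatorics.Transposition"
begin

text \<open>
  Elements are coloured one at a time, while each \<open>X \<in> F\<close> keeps its number of colours plus its
  number of uncoloured elements at least \<open>g X\<close>; a colour is forbidden for an uncoloured \<open>u\<close> only if
  it occurs in a tight set containing \<open>u\<close>. Inclusion-maximal tight sets do not uncross, so by the
  two-thirds condition they behave like the vertices of a multigraph and the elements of \<open>U\<close> like
  its edges: an element of a maximal tight set \<open>M\<close> lies in at most one tight set \<open>N\<close> not contained
  in \<open>M\<close>. This allows the proof of Vizing's theorem by multifans around \<open>M\<close>: if \<open>u\<close> cannot be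
  coloured, the colours missing at the sets \<open>N\<close> reached by the fan are pairwise disjoint and all
  occur on the fan, so some \<open>N\<close> misses fewer than \<open>card (M \<inter> N)\<close> colours and belongs to the
  family of the \<open>g\<close>-laminarity hypothesis. Shifting the uncoloured element into \<open>N\<close> and repeating
  the argument with centre \<open>N\<close> gives two intersecting sets of that family that do not uncross.
\<close>

section \<open>Components of graphs of maximum degree two\<close>

lemma rtranclp_distinct_path:
  assumes "R\<^sup>*\<^sup>* x y"
  shows "\<exists>p. p \<noteq> [] \<and> hd p = x \<and> last p = y \<and> distinct p \<and> successively R p"
  using assms
proof (induction rule: rtranclp_induct)
  case base
  show ?case by (rule exI[of _ "[x]"]) simp
next
  case (step y z)
  then obtain p where p: "p \<noteq> []" "hd p = x" "last p = y" "distinct p" "successively R p"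
    by blast
  show ?case
  proof (cases "z \<in> set p")
    case False
    then show ?thesis
      using p step.hyps by (intro exI[of _ "p @ [z]"]) (auto simp: successively_append_iff)
  next
    case True
    then obtain q r where "p = q @ z # r" by (meson split_list)
    then show ?thesis
      using p by (intro exI[of _ "q @ [z]"]) (auto simp: successively_append_iff hd_append)
  qed
qed

text \<open>A simple path from \<open>x\<close> to \<open>y\<close> is the whole component: its ends
  have no further neighbour, and each inner vertex already has two on the path. As inner vertices
  have degree two, \<open>z\<close> is an end.\<close>

lemma deg2_component_ends:
  assumes sym: "\<And>v w. adj v w \<Longrightarrow> adj w v"
    and deg2: "\<And>v w1 w2 w3. adj v w1 \<Longrightarrow> adj v w2 \<Longrightarrow> adj v w3 \<Longrightarrow> w1 = w2 \<or> w2 = w3 \<or> w1 = w3"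
    and x: "\<And>w1 w2. adj x w1 \<Longrightarrow> adj x w2 \<Longrightarrow> w1 = w2"
    and y: "\<And>w1 w2. adj y w1 \<Longrightarrow> adj y w2 \<Longrightarrow> w1 = w2"
    and z: "\<And>w1 w2. adj z w1 \<Longrightarrow> adj z w2 \<Longrightarrow> w1 = w2"
    and xy: "adj\<^sup>*\<^sup>* x y" "x \<noteq> y" and xz: "adj\<^sup>*\<^sup>* x z"
  shows "z = x \<or> z = y"
proof -
  obtain p where p: "p \<noteq> []" "hd p = x" "last p = y" "distinct p" "successively adj p"
    using rtranclp_distinct_path[OF xy(1)] by blast
  define n where "n = length p"
  have nx: "p ! 0 = x" and ny: "p ! (n - 1) = y"
    using p by (auto simp: hd_conv_nth last_conv_nth n_def)
  have n2: "n \<ge> 2"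
    using nx ny \<open>x \<noteq> y\<close> p(1) by (cases "n \<ge> 2") (auto simp: n_def not_le less_2_cases_iff)
  have adj: "adj (p ! i) (p ! Suc i)" if "Suc i < n" for i
    using p(5) that by (simp add: successively_conv_nth n_def)
  have inner: "\<exists>w1 w2. w1 \<in> set p \<and> w2 \<in> set p \<and> w1 \<noteq> w2 \<and> adj (p ! i) w1 \<and> adj (p ! i) w2"
    if "0 < i" "Suc i < n" for i
  proof -
    have "adj (p ! i) (p ! (i - 1))" using adj[of "i - 1"] that sym by simp
    moreover have "p ! (i - 1) \<noteq> p ! Suc i"
      using p(4) that by (auto simp: n_def nth_eq_iff_index_eq)
    ultimately show ?thesis
      using adj[OF that(2)] that
      by (intro exI[of _ "p ! (i - 1)"] exI[of _ "p ! Suc i"]) (auto simp: n_def)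
  qed
  have closed: "w \<in> set p" if "v \<in> set p" "adj v w" for v w
  proof -
    obtain i where i: "i < n" "v = p ! i" using \<open>v \<in> set p\<close> by (auto simp: in_set_conv_nth n_def)
    consider "i = 0" | "i = n - 1" "i > 0" | "0 < i" "Suc i < n" using i by linarith
    then show ?thesis
    proof cases
      case 1
      then have "w = p ! 1" using x[of w "p ! 1"] adj[of 0] n2 that i nx by simp
      then show ?thesis using n2 by (simp add: n_def)
    next
      case 2
      then obtain j where j: "i = Suc j" using gr0_implies_Suc by blast
      then have "adj y (p ! j)" using adj[of j] sym i ny 2 by auto
      then have "w = p ! j" using y[of w "p ! j"] that i 2 ny by simp
      then show ?thesis using i j by (simp add: n_def)
    next
      case 3
      from inner[OF 3] obtain w1 w2
        where "w1 \<in> set p" "w2 \<in> set p" "w1 \<noteq> w2" "adj v w1" "adj v w2"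
        unfolding i(2) by blast
      then show ?thesis using deg2[OF that(2), of w1 w2] by blast
    qed
  qed
  have "z \<in> set p"
    using xz
  proof (induction rule: rtranclp_induct)
    case base then show ?case using p by (metis hd_in_set)
  next
    case (step v w) then show ?case using closed by blast
  qed
  then obtain i where i: "i < n" "z = p ! i" by (auto simp: in_set_conv_nth n_def)
  consider "i = 0" | "i = n - 1" | "0 < i" "Suc i < n" using i by linarith
  then show ?thesis
  proof cases
    case 3
    then show ?thesis using inner[OF 3] z i(2) by blast
  qed (use i nx ny in auto)
qed

section \<open>Tight sets\<close>

locale two_thirds_supermodular =
  fixes U :: "'a set" and F :: "'a set set" and g :: "'a set \<Rightarrow> int" and k :: nat
  assumes finite_U: "finite U"
    and F_subset: "F \<subseteq> Pow U"
    and supermodular: "intersecting_two_thirds_supermodular F g"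
    and g_le: "\<And>X. X \<in> F \<Longrightarrow> g X \<le> min (int (card X)) (int k)"
begin

definition uncross :: "'a set \<Rightarrow> 'a set \<Rightarrow> bool" where
  "uncross A B \<longleftrightarrow> A \<union> B \<in> F \<and> A \<inter> B \<in> F \<and> g A + g B \<le> g (A \<union> B) + g (A \<inter> B)"

lemma uncross_sym: "uncross A B \<longleftrightarrow> uncross B A"
  by (auto simp: uncross_def Un_commute Int_commute)

lemma two_thirds:
  assumes "A \<in> F" "B \<in> F" "C \<in> F" "A \<noteq> B" "B \<noteq> C" "A \<noteq> C" "e \<in> A" "e \<in> B" "e \<in> C"
    and "\<not> uncross A B"
  shows "uncross A C" "uncross B C"
proof -
  have "A \<inter> B \<inter> C \<noteq> {}" using assms(7-9) by blast
  then have "uncross C A \<and> uncross B C"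
    using supermodular[unfolded intersecting_two_thirds_supermodular_def, THEN conjunct2,
        rule_format, of A B C] assms(1-6,10)
    unfolding uncross_def by auto
  then show "uncross A C" "uncross B C" using uncross_sym[of A C] by auto
qed

lemma finite_F: "X \<in> F \<Longrightarrow> finite X"
  using F_subset finite_U by (meson PowD finite_subset subsetD)

definition valid :: "('a \<Rightarrow> 'c) \<Rightarrow> bool" where
  "valid \<pi> \<longleftrightarrow> (\<forall>X\<in>F. g X \<le> int (card (\<pi> ` X)))"

definition tight :: "('a \<Rightarrow> 'c) \<Rightarrow> 'a set \<Rightarrow> bool" where
  "tight \<pi> X \<longleftrightarrow> X \<in> F \<and> int (card (\<pi> ` X)) = g X"

definition maxtight :: "('a \<Rightarrow> 'c) \<Rightarrow> 'a set \<Rightarrow> bool" where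
  "maxtight \<pi> M \<longleftrightarrow> tight \<pi> M \<and> (\<forall>X. tight \<pi> X \<longrightarrow> M \<subseteq> X \<longrightarrow> X = M)"

lemma card_image_Un_Int:
  assumes "A \<in> F" "B \<in> F"
  shows "card (\<pi> ` (A \<union> B)) + card (\<pi> ` A \<inter> \<pi> ` B) = card (\<pi> ` A) + card (\<pi> ` B)"
  using assms finite_F card_Un_Int[of "\<pi> ` A" "\<pi> ` B"] by (simp add: image_Un)

lemma card_image_Int_le:
  assumes "A \<in> F"
  shows "card (\<pi> ` (A \<inter> B)) \<le> card (\<pi> ` A \<inter> \<pi> ` B)"
  using assms finite_F by (intro card_mono) auto

text \<open>The images of \<open>A \<union> B\<close> and \<open>A \<inter> B\<close> together have
  at most \<open>g A + g B\<close> colours and, by validity and uncrossing, at least as many. So all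
  inequalities are equalities, also the one behind \<pi>(A \<inter> B) \<subseteq> \<pi>(A) \<inter>
  \<pi>(B).\<close>

lemma tight_uncross:
  assumes "valid \<pi>" "tight \<pi> A" "tight \<pi> B" "uncross A B"
  shows "tight \<pi> (A \<union> B)" "tight \<pi> (A \<inter> B)" "\<pi> ` (A \<inter> B) = \<pi> ` A \<inter> \<pi> ` B"
proof -
  have F: "A \<in> F" "B \<in> F" "A \<union> B \<in> F" "A \<inter> B \<in> F"
    using assms by (auto simp: tight_def uncross_def)
  note c = card_image_Un_Int[OF F(1,2), of \<pi>] card_image_Int_le[OF F(1), of \<pi> B]
  have v: "g (A \<union> B) \<le> int (card (\<pi> ` (A \<union> B)))" "g (A \<inter> B) \<le> int (card (\<pi> ` (A \<inter> B)))"
    using assms(1) F by (auto simp: valid_def)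
  have le: "g A + g B \<le> g (A \<union> B) + g (A \<inter> B)"
    and t: "int (card (\<pi> ` A)) = g A" "int (card (\<pi> ` B)) = g B"
    using assms by (auto simp: uncross_def tight_def)
  show "tight \<pi> (A \<union> B)" "tight \<pi> (A \<inter> B)"
    using c v le t F unfolding tight_def by linarith+
  have "card (\<pi> ` A \<inter> \<pi> ` B) = card (\<pi> ` (A \<inter> B))" using c v le t by linarith
  moreover have "\<pi> ` (A \<inter> B) \<subseteq> \<pi> ` A \<inter> \<pi> ` B" by blast
  moreover have "finite (\<pi> ` A \<inter> \<pi> ` B)" using F(1) finite_F by blast
  ultimately show "\<pi> ` (A \<inter> B) = \<pi> ` A \<inter> \<pi> ` B" by (metis card_subset_eq)
qed

lemma maxtight_tight: "maxtight \<pi> M \<Longrightarrow> tight \<pi> M"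
  by (simp add: maxtight_def)

lemma tight_F: "tight \<pi> X \<Longrightarrow> X \<in> F"
  by (simp add: tight_def)

lemma maxtight_uncross_subset:
  assumes "valid \<pi>" "maxtight \<pi> M" "tight \<pi> X" "uncross M X"
  shows "X \<subseteq> M"
  using tight_uncross(1)[OF assms(1) maxtight_tight[OF assms(2)] assms(3,4)] assms(2)
  unfolding maxtight_def by blast

text \<open>Uncrossing \<open>M\<close> with a tight set not inside it would yield a larger tight
  set, so \<open>M\<close> uncrosses with neither \<open>X\<close> nor \<open>Y\<close>; the
  two-thirds condition allows only one such failing pair. In the multigraph picture, the edge
  \<open>e\<close> at \<open>M\<close> has at most one other end.\<close>

lemma outer_unique:
  assumes "valid \<pi>" "maxtight \<pi> M" "e \<in> M"
    and "tight \<pi> X" "e \<in> X" "\<not> X \<subseteq> M" and "tight \<pi> Y" "e \<in> Y" "\<not> Y \<subseteq> M"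
  shows "X = Y"
proof (rule ccontr)
  assume "X \<noteq> Y"
  moreover have "\<not> uncross M X" using maxtight_uncross_subset assms by blast
  ultimately have "uncross M Y"
    using two_thirds(1)[of M X Y e] assms maxtight_tight tight_F by blast
  then show False using maxtight_uncross_subset assms by blast
qed

lemma outer_maxtight:
  assumes "valid \<pi>" "maxtight \<pi> M" "e \<in> M" "tight \<pi> X" "e \<in> X" "\<not> X \<subseteq> M"
  shows "maxtight \<pi> X"
  unfolding maxtight_def using outer_unique[OF assms(1-3)] assms(4-6) by blast

lemma ex_maxtight:
  assumes "tight \<pi> X"
  shows "\<exists>M. maxtight \<pi> M \<and> X \<subseteq> M"
proof -
  have "finite {Y. tight \<pi> Y}"
    using F_subset finite_U by (rule_tac finite_subset[of _ "Pow U"]) (auto simp: tight_def)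
  from finite_has_maximal2[OF this, of X] assms
  obtain M where "tight \<pi> M" "X \<subseteq> M" "\<forall>Y\<in>{Y. tight \<pi> Y}. M \<subseteq> Y \<longrightarrow> M = Y" by auto
  then show ?thesis unfolding maxtight_def by blast
qed

section \<open>Kempe chains\<close>

text \<open>Colours other than \<open>a\<close> and \<open>b\<close> are unaffected, and a set
  having \<open>a\<close> or \<open>b\<close> keeps at least one of them. A loss therefore means a
  drop from both colours to exactly one.\<close>

lemma recolor_card_less:
  assumes "Z \<in> F" and same: "\<And>x. x \<in> Z \<Longrightarrow> \<pi>' x = \<pi> x \<or> \<pi> x \<in> {a, b} \<and> \<pi>' x \<in> {a, b}"
    and "card (\<pi>' ` Z) < card (\<pi> ` Z)"
  shows "a \<in> \<pi> ` Z" "b \<in> \<pi> ` Z" "card (\<pi> ` Z) = card (\<pi>' ` Z) + 1" "\<not> (a \<in> \<pi>' ` Z \<and> b \<in> \<pi>' ` Z)"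
proof -
  have fin: "finite Z" using assms(1) finite_F by blast
  have split: "card (f ` Z) = card (f ` Z - {a, b}) + card (f ` Z \<inter> {a, b})" for f
    using fin card_Diff_subset_Int[of "f ` Z" "{a, b}"] card_mono[of "f ` Z" "f ` Z \<inter> {a, b}"] by simp
  have eq: "\<pi>' ` Z - {a, b} = \<pi> ` Z - {a, b}"
  proof (intro equalityI subsetI)
    fix c assume "c \<in> \<pi>' ` Z - {a, b}"
    then obtain x where "x \<in> Z" "c = \<pi>' x" "c \<notin> {a, b}" by blast
    then show "c \<in> \<pi> ` Z - {a, b}" using same[of x] by auto
  next
    fix c assume "c \<in> \<pi> ` Z - {a, b}"
    then obtain x where "x \<in> Z" "c = \<pi> x" "c \<notin> {a, b}" by blast
    then have "c = \<pi>' x" using same[of x] by auto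
    then show "c \<in> \<pi>' ` Z - {a, b}" using \<open>x \<in> Z\<close> \<open>c \<notin> {a, b}\<close> by blast
  qed
  have lt: "card (\<pi>' ` Z \<inter> {a, b}) < card (\<pi> ` Z \<inter> {a, b})"
    using assms(3) split[of \<pi>] split[of \<pi>'] eq by simp
  have "\<pi> ` Z \<inter> {a, b} \<noteq> {}" using lt by force
  then obtain x where "x \<in> Z" "\<pi> x \<in> {a, b}" by blast
  then have "\<pi>' x \<in> {a, b}" using same[of x] by auto
  then have "\<pi>' ` Z \<inter> {a, b} \<noteq> {}" using \<open>x \<in> Z\<close> by blast
  then have pos: "card (\<pi>' ` Z \<inter> {a, b}) > 0" by (simp add: card_gt_0_iff)
  have le2: "card (\<pi> ` Z \<inter> {a, b}) \<le> card {a, b}" by (intro card_mono) auto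
  have two: "card {a, b} \<le> 2" by (simp add: card_insert_if)
  have "card (\<pi> ` Z \<inter> {a, b}) = 2" "card (\<pi>' ` Z \<inter> {a, b}) = 1" using lt pos le2 two by linarith+
  note c = this
  have "\<pi> ` Z \<inter> {a, b} = {a, b}"
    using c le2 two by (intro card_subset_eq) auto
  then show "a \<in> \<pi> ` Z" "b \<in> \<pi> ` Z" by blast+
  show "card (\<pi> ` Z) = card (\<pi>' ` Z) + 1"
    using c split[of \<pi>] split[of \<pi>'] eq by simp
  show "\<not> (a \<in> \<pi>' ` Z \<and> b \<in> \<pi>' ` Z)"
  proof
    assume "a \<in> \<pi>' ` Z \<and> b \<in> \<pi>' ` Z"
    then have "\<pi>' ` Z \<inter> {a, b} = {a, b}" by blast
    then show False using c le2 by simp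
  qed
qed

definition swap_colors :: "'c \<Rightarrow> 'c \<Rightarrow> 'a set \<Rightarrow> ('a \<Rightarrow> 'c) \<Rightarrow> 'a \<Rightarrow> 'c" where
  "swap_colors a b C \<pi> x = (if x \<in> C then transpose a b (\<pi> x) else \<pi> x)"

lemma swap_colors_cases:
  "swap_colors a b C \<pi> x = \<pi> x \<or> \<pi> x \<in> {a, b} \<and> swap_colors a b C \<pi> x \<in> {a, b}"
  by (auto simp: swap_colors_def transpose_def)

definition double :: "('a \<Rightarrow> 'c) \<Rightarrow> 'c \<Rightarrow> 'c \<Rightarrow> 'a set \<Rightarrow> bool" where
  "double \<pi> a b X \<longleftrightarrow> tight \<pi> X \<and> a \<in> \<pi> ` X \<and> b \<in> \<pi> ` X"

definition mindouble :: "('a \<Rightarrow> 'c) \<Rightarrow> 'c \<Rightarrow> 'c \<Rightarrow> 'a set \<Rightarrow> bool" where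
  "mindouble \<pi> a b X \<longleftrightarrow> double \<pi> a b X \<and> (\<forall>Y. double \<pi> a b Y \<longrightarrow> Y \<subseteq> X \<longrightarrow> Y = X)"

text \<open>One representative per colour is fixed, so that a set contributes a single edge to the
  graph below and three neighbours of a vertex require three sets.\<close>

definition rep :: "('a \<Rightarrow> 'c) \<Rightarrow> 'c \<Rightarrow> 'a set \<Rightarrow> 'a" where
  "rep \<pi> c X = (SOME x. x \<in> X \<and> \<pi> x = c)"

text \<open>The components of this graph play the role of Kempe chains: exchanging the two colours on a
  component keeps both of them on each minimal tight set that has both, hence on each tight set
  that has both.\<close>

definition kadj :: "('a \<Rightarrow> 'c) \<Rightarrow> 'c \<Rightarrow> 'c \<Rightarrow> 'a \<Rightarrow> 'a \<Rightarrow> bool" where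
  "kadj \<pi> a b x y \<longleftrightarrow> (\<exists>X. mindouble \<pi> a b X \<and>
     (x = rep \<pi> a X \<and> y = rep \<pi> b X \<or> x = rep \<pi> b X \<and> y = rep \<pi> a X))"

lemma rep:
  assumes "c \<in> \<pi> ` X"
  shows "rep \<pi> c X \<in> X" "\<pi> (rep \<pi> c X) = c"
  using someI_ex[of "\<lambda>x. x \<in> X \<and> \<pi> x = c"] assms unfolding rep_def by auto

lemma mindouble_rep:
  assumes "mindouble \<pi> a b X"
  shows "rep \<pi> a X \<in> X" "\<pi> (rep \<pi> a X) = a" "rep \<pi> b X \<in> X" "\<pi> (rep \<pi> b X) = b"
  using assms rep[of a \<pi> X] rep[of b \<pi> X] by (auto simp: mindouble_def double_def)

lemma kadj_sym: "kadj \<pi> a b x y \<Longrightarrow> kadj \<pi> a b y x"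
  unfolding kadj_def by blast

lemma kadjD:
  assumes "kadj \<pi> a b x y" "a \<noteq> b"
  shows "\<exists>X. mindouble \<pi> a b X \<and> x \<in> X \<and> y = rep \<pi> (if \<pi> x = a then b else a) X"
proof -
  obtain X where X: "mindouble \<pi> a b X"
    and "x = rep \<pi> a X \<and> y = rep \<pi> b X \<or> x = rep \<pi> b X \<and> y = rep \<pi> a X"
    using assms(1) unfolding kadj_def by blast
  then have "x \<in> X \<and> y = rep \<pi> (if \<pi> x = a then b else a) X"
    using mindouble_rep[OF X] assms(2) by auto
  then show ?thesis using X by blast
qed

text \<open>If two minimal sets uncross, their intersection is tight and has both colours, so
  minimality makes them equal. Three distinct ones through \<open>x\<close> would thus contradict
  the two-thirds condition.\<close>

lemma mindouble_three:
  assumes "valid \<pi>" "mindouble \<pi> a b X" "mindouble \<pi> a b Y" "mindouble \<pi> a b Z"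
    and "x \<in> X" "x \<in> Y" "x \<in> Z"
  shows "X = Y \<or> Y = Z \<or> X = Z"
proof -
  have *: "A = B" if "mindouble \<pi> a b A" "mindouble \<pi> a b B" "uncross A B" for A B
  proof -
    have "double \<pi> a b (A \<inter> B)"
      using tight_uncross[OF assms(1) _ _ that(3)] that(1,2)
      by (auto simp: mindouble_def double_def)
    then have "A \<inter> B = A" "A \<inter> B = B" using that(1,2) unfolding mindouble_def by blast+
    then show ?thesis by simp
  qed
  have F: "X \<in> F" "Y \<in> F" "Z \<in> F"
    using assms by (auto simp: mindouble_def double_def tight_def)
  have "\<not> uncross X Y" "\<not> uncross X Z" if "X \<noteq> Y" "X \<noteq> Z"
    using *[OF assms(2,3)] *[OF assms(2,4)] that by auto
  then show ?thesis
    using two_thirds(1)[OF F _ _ _ assms(5-7)] by blast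
qed

lemma kadj_deg2:
  assumes "valid \<pi>" "a \<noteq> b" "kadj \<pi> a b x w1" "kadj \<pi> a b x w2" "kadj \<pi> a b x w3"
  shows "w1 = w2 \<or> w2 = w3 \<or> w1 = w3"
proof -
  obtain X Y Z where "mindouble \<pi> a b X" "x \<in> X" "w1 = rep \<pi> (if \<pi> x = a then b else a) X"
    and "mindouble \<pi> a b Y" "x \<in> Y" "w2 = rep \<pi> (if \<pi> x = a then b else a) Y"
    and "mindouble \<pi> a b Z" "x \<in> Z" "w3 = rep \<pi> (if \<pi> x = a then b else a) Z"
    using kadjD[OF assms(3,2)] kadjD[OF assms(4,2)] kadjD[OF assms(5,2)] by blast
  then show ?thesis using mindouble_three[OF assms(1), of a b X Y Z x] by blast
qed

text \<open>A set \<open>N\<close> lacking one of the colours contains no set that has both, so each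
  edge at \<open>x\<close> comes from a tight set not inside \<open>N\<close>; by
  \<open>outer_unique\<close> there is only one.\<close>

lemma kadj_deg1:
  assumes "valid \<pi>" "a \<noteq> b" "maxtight \<pi> N" "x \<in> N" "a \<notin> \<pi> ` N \<or> b \<notin> \<pi> ` N"
    and "kadj \<pi> a b x w1" "kadj \<pi> a b x w2"
  shows "w1 = w2"
proof -
  obtain X Y where X: "mindouble \<pi> a b X" "x \<in> X" "w1 = rep \<pi> (if \<pi> x = a then b else a) X"
    and Y: "mindouble \<pi> a b Y" "x \<in> Y" "w2 = rep \<pi> (if \<pi> x = a then b else a) Y"
    using kadjD[OF assms(6,2)] kadjD[OF assms(7,2)] by blast
  have "tight \<pi> X" "tight \<pi> Y" "\<not> X \<subseteq> N" "\<not> Y \<subseteq> N"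
    using X(1) Y(1) assms(5) unfolding mindouble_def double_def by blast+
  then have "X = Y" using outer_unique[OF assms(1,3,4)] X(2) Y(2) by blast
  then show ?thesis using X Y by simp
qed

lemma double_contains_mindouble:
  assumes "double \<pi> a b X"
  shows "\<exists>Y. mindouble \<pi> a b Y \<and> Y \<subseteq> X"
proof -
  have "finite {Y. double \<pi> a b Y}"
    using F_subset finite_U
    by (rule_tac finite_subset[of _ "Pow U"]) (auto simp: double_def tight_def)
  from finite_has_minimal2[OF this, of X] assms
  obtain M where "double \<pi> a b M" "M \<subseteq> X" "\<forall>Y\<in>{Y. double \<pi> a b Y}. Y \<subseteq> M \<longrightarrow> M = Y" by auto
  then show ?thesis unfolding mindouble_def by blast
qed

lemma double_swap:
  assumes "double \<pi> a b X" and closed: "\<And>x y. kadj \<pi> a b x y \<Longrightarrow> x \<in> C \<Longrightarrow> y \<in> C"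
  shows "a \<in> swap_colors a b C \<pi> ` X" "b \<in> swap_colors a b C \<pi> ` X"
proof -
  obtain Y where Y: "mindouble \<pi> a b Y" "Y \<subseteq> X" using double_contains_mindouble[OF assms(1)] by blast
  let ?x = "rep \<pi> a Y" and ?y = "rep \<pi> b Y"
  have r: "?x \<in> X" "?y \<in> X" "\<pi> ?x = a" "\<pi> ?y = b" using mindouble_rep[OF Y(1)] Y(2) by auto
  have "kadj \<pi> a b ?x ?y" "kadj \<pi> a b ?y ?x" using Y(1) unfolding kadj_def by blast+
  then have "?x \<in> C \<longleftrightarrow> ?y \<in> C" using closed[of ?x ?y] closed[of ?y ?x] by blast
  then have "swap_colors a b C \<pi> ?x = a \<and> swap_colors a b C \<pi> ?y = b \<or>
      swap_colors a b C \<pi> ?x = b \<and> swap_colors a b C \<pi> ?y = a"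
    using r by (auto simp: swap_colors_def)
  then show "a \<in> swap_colors a b C \<pi> ` X" "b \<in> swap_colors a b C \<pi> ` X"
    using imageI[OF r(1), of "swap_colors a b C \<pi>"] imageI[OF r(2), of "swap_colors a b C \<pi>"]
    by auto
qed

text \<open>A set loses at most one colour, and only if it had both \<open>a\<close> and
  \<open>b\<close> and keeps just one of them. Tight sets never do this by
  \<open>double_swap\<close>; all others have a colour to spare.\<close>

lemma swap_valid:
  assumes "valid \<pi>" and closed: "\<And>x y. kadj \<pi> a b x y \<Longrightarrow> x \<in> C \<Longrightarrow> y \<in> C"
  shows "valid (swap_colors a b C \<pi>)"
  unfolding valid_def
proof
  fix X assume X: "X \<in> F"
  have g: "g X \<le> int (card (\<pi> ` X))" using assms(1) X by (simp add: valid_def)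
  show "g X \<le> int (card (swap_colors a b C \<pi> ` X))"
  proof (cases "card (swap_colors a b C \<pi> ` X) < card (\<pi> ` X)")
    case True
    note r = recolor_card_less[OF X swap_colors_cases True]
    have "\<not> tight \<pi> X"
      using r(1,2,4) double_swap[of \<pi> a b X C] closed unfolding double_def by blast
    then show ?thesis using g r(3) X by (simp add: tight_def)
  qed (use g in linarith)
qed

lemma recolor_card_greater:
  assumes "X \<in> F" and same: "\<And>x. x \<in> X \<Longrightarrow> \<pi>' x = \<pi> x \<or> \<pi> x \<in> {a, b} \<and> \<pi>' x \<in> {a, b}"
    and "a \<in> \<pi>' ` X" "b \<in> \<pi>' ` X" "a \<notin> \<pi> ` X \<or> b \<notin> \<pi> ` X"
  shows "card (\<pi> ` X) < card (\<pi>' ` X)"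
proof (rule psubset_card_mono)
  show "finite (\<pi>' ` X)" using finite_F[OF assms(1)] by simp
  have "\<pi> x \<in> \<pi>' ` X" if "x \<in> X" for x
    using same[OF that] assms(3,4) imageI[OF that, of \<pi>'] by auto
  then show "\<pi> ` X \<subset> \<pi>' ` X" using assms(3-5) by blast
qed

lemma swap_tight_new:
  assumes "valid \<pi>" "tight (swap_colors a b C \<pi>) X" "\<not> tight \<pi> X"
  shows "a \<in> \<pi> ` X" "b \<in> \<pi> ` X" "int (card (\<pi> ` X)) = g X + 1"
    "\<not> (a \<in> swap_colors a b C \<pi> ` X \<and> b \<in> swap_colors a b C \<pi> ` X)"
proof -
  have X: "X \<in> F" using assms(2) by (rule tight_F)
  have "card (swap_colors a b C \<pi> ` X) < card (\<pi> ` X)"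
    using assms X by (auto simp: valid_def tight_def order_less_le)
  note r = recolor_card_less[OF X swap_colors_cases this]
  show "a \<in> \<pi> ` X" "b \<in> \<pi> ` X"
    "\<not> (a \<in> swap_colors a b C \<pi> ` X \<and> b \<in> swap_colors a b C \<pi> ` X)" using r by auto
  show "int (card (\<pi> ` X)) = g X + 1" using r(3) assms(2) by (simp add: tight_def)
qed

section \<open>Multifans\<close>

abbreviation colors :: "(nat + 'a) set" where
  "colors \<equiv> Inl ` {1..k}"

text \<open>A partial colouring with domain \<open>D\<close>: an uncoloured element counts as a private colour
  \<open>Inr x\<close> of its own, so that the deficit of a set is read off the cardinality of its image.\<close>

definition coloring :: "('a \<Rightarrow> nat + 'a) \<Rightarrow> 'a set \<Rightarrow> bool" where
  "coloring \<pi> D \<longleftrightarrow> (\<forall>x\<in>U. if x \<in> D then \<pi> x \<in> colors else \<pi> x = Inr x)"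

text \<open>For a valid colouring and \<open>e\<close> in a maximal tight set \<open>M\<close>,
  these are the colours absent from the other end of the edge \<open>e\<close>, the tight set
  through \<open>e\<close> not inside \<open>M\<close>; without such a set they are all
  colours.\<close>

definition missing :: "('a \<Rightarrow> nat + 'a) \<Rightarrow> 'a set \<Rightarrow> 'a \<Rightarrow> (nat + 'a) set" where
  "missing \<pi> M e = {c \<in> colors. \<forall>X. tight \<pi> X \<longrightarrow> e \<in> X \<longrightarrow> \<not> X \<subseteq> M \<longrightarrow> c \<notin> \<pi> ` X}"

definition fan_step :: "('a \<Rightarrow> nat + 'a) \<Rightarrow> 'a set \<Rightarrow> 'a \<Rightarrow> 'a \<Rightarrow> bool" where
  "fan_step \<pi> M v w \<longleftrightarrow> w \<in> M \<and> \<pi> w \<in> missing \<pi> M v"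

text \<open>The list holds the colours of the elements after the first. They are distinct so that
  the rest is still a fan after a shift along the first step (\<open>fan_shifted\<close>).\<close>

inductive fan :: "('a \<Rightarrow> nat + 'a) \<Rightarrow> 'a set \<Rightarrow> 'a \<Rightarrow> 'a \<Rightarrow> (nat + 'a) list \<Rightarrow> bool"
  for \<pi> M where
  Nil: "fan \<pi> M e e []"
| Cons: "fan_step \<pi> M v w \<Longrightarrow> fan \<pi> M w e cs \<Longrightarrow> \<pi> w \<notin> set cs \<Longrightarrow> fan \<pi> M v e (\<pi> w # cs)"

inductive_cases fan_NilE: "fan \<pi> M v e []"
inductive_cases fan_ConsE: "fan \<pi> M v e (c # cs)"

lemma fan_shortcut:
  assumes "fan \<pi> M v e cs" "c \<in> set cs"
  shows "\<exists>w cs'. w \<in> M \<and> \<pi> w = c \<and> fan \<pi> M w e cs' \<and> c \<notin> set cs'"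
  using assms
proof induction
  case (Cons v w e cs)
  then show ?case by (cases "c = \<pi> w") (auto simp: fan_step_def)
qed simp

text \<open>Whether a step is possible depends on its target in \<open>M\<close> only through the
  colour, so a repeated colour allows a direct step to the last element that has it.\<close>

lemma fan_if_reachable:
  assumes "(fan_step \<pi> M)\<^sup>*\<^sup>* v e"
  shows "\<exists>cs. fan \<pi> M v e cs"
  using assms
proof (induction rule: converse_rtranclp_induct)
  case base
  show ?case using fan.Nil by blast
next
  case (step v w)
  then obtain cs where cs: "fan \<pi> M w e cs" by blast
  show ?case
  proof (cases "\<pi> w \<in> set cs")
    case False
    then show ?thesis using fan.Cons[OF step.hyps(1) cs] by blast
  next
    case True
    from fan_shortcut[OF cs this] obtain w' cs'
      where w': "w' \<in> M" "\<pi> w' = \<pi> w" "fan \<pi> M w' e cs'" "\<pi> w \<notin> set cs'" by blast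
    then have "fan_step \<pi> M v w'" using step.hyps(1) by (simp add: fan_step_def)
    from fan.Cons[OF this w'(3)] show ?thesis using w' by auto
  qed
qed

lemma reachable_in:
  assumes "(fan_step \<pi> M)\<^sup>*\<^sup>* u e" "u \<in> M"
  shows "e \<in> M"
  using assms by (induction rule: rtranclp_induct) (auto simp: fan_step_def)

end

section \<open>Colourings with one uncoloured element left, when no valid completion exists\<close>

locale no_extension = two_thirds_supermodular U F g k
  for U :: "'a set" and F g k +
  fixes D :: "'a set"
  assumes D_subset: "D \<subseteq> U"
    and not_colorable: "\<And>\<pi>. coloring \<pi> D \<Longrightarrow> \<not> valid \<pi>"
begin

text \<open>\<open>M\<close> is the centre of the fan and \<open>u\<close> the one uncoloured
  element of \<open>D\<close>. Both vary: shifting moves \<open>u\<close>, and the outer set at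
  \<open>u\<close> may take the place of \<open>M\<close>.\<close>

definition state :: "('a \<Rightarrow> nat + 'a) \<Rightarrow> 'a \<Rightarrow> 'a set \<Rightarrow> bool" where
  "state \<pi> u M \<longleftrightarrow> u \<in> D \<and> coloring \<pi> (D - {u}) \<and> valid \<pi> \<and> maxtight \<pi> M \<and> u \<in> M"

lemma uncolored:
  assumes "coloring \<pi> (D - {u})" "u \<in> D"
  shows "\<pi> u = Inr u" "x \<in> U \<Longrightarrow> x \<noteq> u \<Longrightarrow> \<pi> x \<noteq> Inr u"
proof -
  show "\<pi> u = Inr u" using assms D_subset by (auto simp: coloring_def)
  assume "x \<in> U" "x \<noteq> u"
  then have "if x \<in> D - {u} then \<pi> x \<in> colors else \<pi> x = Inr x"
    using assms(1) unfolding coloring_def by blast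
  then show "\<pi> x \<noteq> Inr u" using \<open>x \<noteq> u\<close> by (auto split: if_splits)
qed

lemma card_remove_uncolored:
  assumes "coloring \<pi> (D - {u})" "u \<in> D" "X \<in> F" "u \<in> X"
  shows "card (\<pi> ` X) = Suc (card (\<pi> ` (X - {u})))"
proof -
  have "X \<subseteq> U" using assms(3) F_subset by blast
  then have "Inr u \<notin> \<pi> ` (X - {u})" using uncolored(2)[OF assms(1,2)] by force
  moreover have "\<pi> ` X = insert (Inr u) (\<pi> ` (X - {u}))"
    using uncolored(1)[OF assms(1,2)] assms(4) by force
  ultimately show ?thesis using finite_F[OF assms(3)] by simp
qed

text \<open>Give \<open>u\<close> the colour \<open>c\<close>: only a set through \<open>u\<close>
  that already has \<open>c\<close> loses one from its count. As the result cannot be valid, some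
  such set was tight.\<close>

lemma color_blocked:
  assumes "coloring \<pi> (D - {u})" "u \<in> D" "valid \<pi>" "c \<in> colors"
  shows "\<exists>X. tight \<pi> X \<and> u \<in> X \<and> c \<in> \<pi> ` X"
proof (rule ccontr)
  assume n: "\<not> ?thesis"
  let ?\<pi> = "\<pi>(u := c)"
  have "coloring ?\<pi> D" using assms by (auto simp: coloring_def)
  moreover have "valid ?\<pi>"
    unfolding valid_def
  proof
    fix X assume X: "X \<in> F"
    have g: "g X \<le> int (card (\<pi> ` X))" using assms(3) X by (simp add: valid_def)
    show "g X \<le> int (card (?\<pi> ` X))"
    proof (cases "u \<in> X")
      case False
      then have "?\<pi> ` X = \<pi> ` X" by (intro image_cong) auto
      then show ?thesis using g by simp
    next
      case True
      note c = card_remove_uncolored[OF assms(1,2) X True]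
      have e: "?\<pi> ` X = insert c (\<pi> ` (X - {u}))" using True by auto
      have fin: "finite (\<pi> ` (X - {u}))" using finite_F[OF X] by simp
      show ?thesis
      proof (cases "tight \<pi> X")
        case True
        then have "c \<notin> \<pi> ` (X - {u})" using n \<open>u \<in> X\<close> by blast
        then show ?thesis using c e fin g by simp
      next
        case False
        then have "g X < int (card (\<pi> ` X))" using g X by (auto simp: tight_def)
        moreover have "card (\<pi> ` (X - {u})) \<le> card (?\<pi> ` X)"
          unfolding e by (intro card_mono) (use fin in auto)
        ultimately show ?thesis using c by linarith
      qed
    qed
  qed
  ultimately show False using not_colorable by blast
qed

text \<open>A tight set has at most \<open>k\<close> colours in its image, and one of them is the
  private colour of \<open>u\<close>.\<close>

lemma free_color:
  assumes "coloring \<pi> (D - {u})" "u \<in> D" "tight \<pi> M" "u \<in> M"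
  shows "\<exists>a\<in>colors. a \<notin> \<pi> ` M"
proof (rule ccontr)
  assume "\<not> ?thesis"
  then have "insert (Inr u) colors \<subseteq> \<pi> ` M"
    using uncolored(1)[OF assms(1,2)] assms(4) by (metis image_eqI insert_subset subsetI)
  moreover have "finite (\<pi> ` M)" using finite_F assms(3) tight_F by blast
  ultimately have "card (insert (Inr u) colors) \<le> card (\<pi> ` M)" by (rule card_mono[rotated])
  moreover have "card (insert (Inr u :: nat + 'a) colors) = Suc k"
    by (subst card_insert_disjoint) (auto simp: card_image)
  ultimately show False using g_le[OF tight_F[OF assms(3)]] assms(3) by (simp add: tight_def)
qed

lemma stateD:
  assumes "state \<pi> u M"
  shows "u \<in> D" "coloring \<pi> (D - {u})" "valid \<pi>" "maxtight \<pi> M" "u \<in> M"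
    "tight \<pi> M" "M \<subseteq> U"
  using assms F_subset maxtight_tight tight_F unfolding state_def by blast+

lemma outer_exists:
  assumes "state \<pi> u M"
  shows "\<exists>N. tight \<pi> N \<and> u \<in> N \<and> \<not> N \<subseteq> M"
proof -
  note s = stateD[OF assms]
  obtain a where "a \<in> colors" "a \<notin> \<pi> ` M" using free_color[OF s(2,1,6,5)] by blast
  then show ?thesis using color_blocked[OF s(2,1,3), of a] by blast
qed

text \<open>The roles of \<open>M\<close> and \<open>N\<close> are symmetric: \<open>N\<close> is
  maximal tight as well, and \<open>M\<close> is the only tight set through \<open>u\<close> that is
  not inside it.\<close>

lemma inner_subset:
  assumes "state \<pi> u M" "tight \<pi> N" "u \<in> N" "\<not> N \<subseteq> M" "tight \<pi> X" "u \<in> X" "X \<noteq> M"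
  shows "X \<subseteq> N"
proof -
  note s = stateD[OF assms(1)]
  have N: "maxtight \<pi> N" using outer_maxtight s assms by blast
  then have "\<not> M \<subseteq> N" using assms(4) s(6) s(4) assms(2) unfolding maxtight_def by blast
  then show ?thesis using outer_unique[OF s(3) N assms(3) assms(5,6) _ s(6,5)] assms(7) by blast
qed

lemma missing_color:
  assumes "state \<pi> u M" "c \<in> missing \<pi> M u"
  shows "c \<in> \<pi> ` M"
proof -
  have "c \<in> colors" using assms(2) by (simp add: missing_def)
  then obtain X where "tight \<pi> X" "u \<in> X" "c \<in> \<pi> ` X"
    using color_blocked stateD(1,2,3)[OF assms(1)] by blast
  then show ?thesis using assms(2) by (auto simp: missing_def)
qed

section \<open>Shifting the uncoloured element along one fan step\<close>

context
  fixes \<pi> u M v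
  assumes state: "state \<pi> u M" and step: "fan_step \<pi> M u v"
begin

definition shifted :: "'a \<Rightarrow> nat + 'a" where
  "shifted = \<pi>(u := \<pi> v, v := Inr v)"

lemma step_facts: "v \<in> M" "\<pi> v \<in> colors" "v \<noteq> u" "v \<in> D"
  "tight \<pi> X \<Longrightarrow> u \<in> X \<Longrightarrow> \<not> X \<subseteq> M \<Longrightarrow> \<pi> v \<notin> \<pi> ` X"
proof -
  note s = stateD[OF state]
  show v: "v \<in> M" "\<pi> v \<in> colors"
    "tight \<pi> X \<Longrightarrow> u \<in> X \<Longrightarrow> \<not> X \<subseteq> M \<Longrightarrow> \<pi> v \<notin> \<pi> ` X"
    using step by (auto simp: fan_step_def missing_def)
  show "v \<noteq> u" using v uncolored(1)[OF s(2,1)] by auto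
  show "v \<in> D" using v s(2,7) by (auto simp: coloring_def split: if_splits)
qed

lemma tight_missing_step:
  assumes "tight \<pi> X" "u \<in> X" "v \<notin> X"
  shows "\<pi> v \<notin> \<pi> ` X"
proof -
  obtain N where N: "tight \<pi> N" "u \<in> N" "\<not> N \<subseteq> M" using outer_exists[OF state] by blast
  have "X \<subseteq> N" using inner_subset[OF state N assms(1,2)] assms(3) step_facts(1) by blast
  then show ?thesis using step_facts(5)[OF N] by blast
qed

lemma shifted_coloring: "coloring shifted (D - {v})"
  using stateD(1,2)[OF state] step_facts(2,3) D_subset unfolding coloring_def shifted_def by auto

lemma shifted_image_both:
  assumes "X \<in> F" "u \<in> X" "v \<in> X"
  shows "card (shifted ` X) = card (\<pi> ` X)"
proof -
  note s = stateD[OF state]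
  have Uv: "X \<subseteq> U" using assms(1) F_subset by blast
  have "shifted ` (X - {v}) = \<pi> ` (X - {u})"
  proof (intro equalityI subsetI)
    fix c assume "c \<in> shifted ` (X - {v})"
    then obtain x where "x \<in> X" "x \<noteq> v" "c = shifted x" by blast
    then show "c \<in> \<pi> ` (X - {u})"
      using assms step_facts(3) by (cases "x = u") (auto simp: shifted_def)
  next
    fix c assume "c \<in> \<pi> ` (X - {u})"
    then obtain x where x: "x \<in> X" "x \<noteq> u" "c = \<pi> x" by blast
    show "c \<in> shifted ` (X - {v})"
    proof (cases "x = v")
      case True
      then have "c = shifted u" using x step_facts(3) by (simp add: shifted_def)
      then show ?thesis using assms step_facts(3) by blast
    next
      case False
      then have "c = shifted x" using x by (simp add: shifted_def)
      then show ?thesis using x False by blast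
    qed
  qed
  then show ?thesis
    using card_remove_uncolored[OF s(2,1) assms(1,2)]
      card_remove_uncolored[OF shifted_coloring step_facts(4) assms(1,3)] by simp
qed

lemma shifted_card_v:
  assumes "X \<in> F" "u \<notin> X" "v \<in> X"
  shows "card (shifted ` X) = card (\<pi> ` X) + (if \<pi> v \<in> \<pi> ` (X - {v}) then 1 else 0)"
proof -
  have e: "shifted ` (X - {v}) = \<pi> ` (X - {v})"
    using assms(2) by (intro image_cong) (auto simp: shifted_def)
  have "\<pi> ` X = insert (\<pi> v) (\<pi> ` (X - {v}))" using assms(3) by blast
  then show ?thesis
    using card_remove_uncolored[OF shifted_coloring step_facts(4) assms(1,3)] e
      finite_F[OF assms(1)] by (simp add: insert_absorb)
qed

lemma shifted_card_u:
  assumes "X \<in> F" "u \<in> X" "v \<notin> X"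
  shows "card (\<pi> ` X) = card (shifted ` X) + (if \<pi> v \<in> \<pi> ` X then 1 else 0)"
proof -
  note s = stateD[OF state]
  have e: "shifted ` X = insert (\<pi> v) (\<pi> ` (X - {u}))"
    using assms(2,3) by (auto simp: shifted_def)
  have "\<pi> v \<noteq> \<pi> u" using step_facts(2) uncolored(1)[OF s(2,1)] by auto
  then have "\<pi> v \<in> \<pi> ` X \<longleftrightarrow> \<pi> v \<in> \<pi> ` (X - {u})" by auto
  then show ?thesis
    using card_remove_uncolored[OF s(2,1) assms(1,2)] e finite_F[OF assms(1)]
    by (simp add: insert_absorb)
qed

lemma shifted_image_neither: "u \<notin> X \<Longrightarrow> v \<notin> X \<Longrightarrow> shifted ` X = \<pi> ` X"
  by (intro image_cong) (auto simp: shifted_def)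

text \<open>Only a set with \<open>u\<close> but without \<open>v\<close> can lose from its count,
  namely if it already has the colour of \<open>v\<close>; by \<open>tight_missing_step\<close> it
  is then not tight.\<close>

lemma shifted_valid: "valid shifted"
  unfolding valid_def
proof
  fix X assume X: "X \<in> F"
  have g: "g X \<le> int (card (\<pi> ` X))" using stateD(3)[OF state] X by (simp add: valid_def)
  consider "u \<in> X" "v \<in> X" | "u \<notin> X" "v \<in> X" | "u \<in> X" "v \<notin> X" | "u \<notin> X" "v \<notin> X" by blast
  then show "g X \<le> int (card (shifted ` X))"
  proof cases
    case 3
    have "g X < int (card (\<pi> ` X))" if "\<pi> v \<in> \<pi> ` X"
      using tight_missing_step[OF _ 3] that g X by (auto simp: tight_def order_less_le)
    then show ?thesis using shifted_card_u[OF X 3] g by (auto split: if_splits)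
  qed (use g shifted_image_both[OF X] shifted_card_v[OF X] shifted_image_neither in auto)
qed

lemma shifted_tight_both:
  assumes "u \<in> X" "v \<in> X"
  shows "tight shifted X \<longleftrightarrow> tight \<pi> X"
  using shifted_image_both[OF _ assms] by (auto simp: tight_def)

lemma shifted_state: "state shifted v M"
proof -
  note s = stateD[OF state]
  have "maxtight shifted M"
    unfolding maxtight_def
  proof (intro conjI allI impI)
    show "tight shifted M" using shifted_tight_both[OF s(5) step_facts(1)] s(6) by simp
  next
    fix X assume "tight shifted X" "M \<subseteq> X"
    then have "tight \<pi> X" using shifted_tight_both[of X] s(5) step_facts(1) by blast
    then show "X = M" using s(4) \<open>M \<subseteq> X\<close> by (simp add: maxtight_def)
  qed
  then show ?thesis
    using shifted_coloring shifted_valid step_facts by (simp add: state_def)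
qed

text \<open>A newly tight set contains \<open>u\<close> but not \<open>v\<close>. The outer set at
  \<open>u\<close> stays tight under the shift, so by uniqueness the new set would be that old
  one.\<close>

lemma shifted_tight:
  assumes "tight shifted X" "\<not> X \<subseteq> M"
  shows "tight \<pi> X"
proof (rule ccontr)
  assume n: "\<not> tight \<pi> X"
  note s = stateD[OF state]
  have X: "X \<in> F" using assms(1) by (rule tight_F)
  have "g X < int (card (\<pi> ` X))"
    using n X s(3) by (auto simp: tight_def valid_def order_less_le)
  then have lt: "card (shifted ` X) < card (\<pi> ` X)" using assms(1) by (simp add: tight_def)
  then have uv: "u \<in> X" "v \<notin> X"
    using shifted_image_both[OF X] shifted_card_v[OF X] shifted_image_neither[of X]
    by (cases "u \<in> X"; cases "v \<in> X"; simp)+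
  obtain N where N: "tight \<pi> N" "u \<in> N" "\<not> N \<subseteq> M" using outer_exists[OF state] by blast
  have vN: "v \<notin> N" using step_facts(5)[OF N] by blast
  have "tight shifted N"
    using shifted_card_u[OF tight_F[OF N(1)] N(2) vN] step_facts(5)[OF N] N(1)
    by (simp add: tight_def)
  then have "X = N"
    using outer_unique[OF shifted_valid stateD(4)[OF shifted_state] s(5) assms(1) uv(1) assms(2)] N
    by blast
  then show False using n N by blast
qed

lemma missing_shifted:
  assumes "c \<in> missing \<pi> M e" "c \<noteq> \<pi> v"
  shows "c \<in> missing shifted M e"
proof -
  have "c \<notin> shifted ` X" if X: "tight shifted X" "e \<in> X" "\<not> X \<subseteq> M" for X
  proof
    assume "c \<in> shifted ` X"
    then obtain x where "x \<in> X" "c = shifted x" by blast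
    moreover have "c \<in> colors" using assms(1) by (simp add: missing_def)
    ultimately have "c \<in> \<pi> ` X"
      using assms(2) by (auto simp: shifted_def split: if_splits)
    then show False using shifted_tight[OF X(1,3)] X assms(1) by (auto simp: missing_def)
  qed
  then show ?thesis using assms(1) by (simp add: missing_def)
qed

text \<open>A tight set through \<open>v\<close> not inside \<open>M\<close> has the same count
  before and after the shift, so only \<open>v\<close> itself had the old colour of \<open>v\<close>
  there, and the shift removes it.\<close>

lemma missing_shifted_end: "\<pi> v \<in> missing shifted M v"
proof -
  have "\<pi> v \<notin> shifted ` X" if X: "tight shifted X" "v \<in> X" "\<not> X \<subseteq> M" for X
  proof -
    have t: "tight \<pi> X" using shifted_tight X by blast
    have u: "u \<notin> X" using step_facts(5)[OF t] X by blast
    have "card (shifted ` X) = card (\<pi> ` X)" using t X(1) by (simp add: tight_def)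
    then have "\<pi> v \<notin> \<pi> ` (X - {v})"
      using shifted_card_v[OF tight_F[OF t] u X(2)] by (auto split: if_splits)
    then show ?thesis using u step_facts(2) by (auto simp: shifted_def split: if_splits)
  qed
  then show ?thesis using step_facts(2) by (simp add: missing_def)
qed

lemma fan_shifted:
  assumes "fan \<pi> M w e cs" "\<pi> v \<notin> set cs"
  shows "fan shifted M w e cs"
  using assms
proof induction
  case (Cons x y e cs)
  have "\<pi> y \<in> colors" using Cons.hyps(1) by (simp add: fan_step_def missing_def)
  then have "shifted y = \<pi> y"
    using Cons.prems uncolored(1)[OF stateD(2,1)[OF state]] by (auto simp: shifted_def)
  then have "fan_step shifted M x y"
    using Cons.hyps(1) Cons.prems missing_shifted by (auto simp: fan_step_def)
  then show ?case
    using fan.Cons[of shifted M x y e cs] Cons \<open>shifted y = \<pi> y\<close> by auto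
qed (rule fan.Nil)

text \<open>The shift can be undone, as \<open>v\<close> now steps back to \<open>u\<close>. A step
  to an element other than \<open>v\<close> either survives or has the old colour of
  \<open>v\<close>, and then it can be taken from \<open>v\<close> directly.\<close>

lemma reachable_shifted:
  assumes "(fan_step \<pi> M)\<^sup>*\<^sup>* u e"
  shows "(fan_step shifted M)\<^sup>*\<^sup>* v e"
  using assms
proof (induction rule: rtranclp_induct)
  case base
  have "fan_step shifted M v u"
    using missing_shifted_end stateD(5)[OF state] step_facts(3)
    by (simp add: fan_step_def shifted_def)
  then show ?case by blast
next
  case (step x y)
  show ?case
  proof (cases "y = v")
    case False
    have y: "y \<in> M" "\<pi> y \<in> missing \<pi> M x" using step.hyps(2) by (auto simp: fan_step_def)
    then have "\<pi> y \<in> colors" by (simp add: missing_def)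
    then have "y \<noteq> u" using uncolored(1)[OF stateD(2,1)[OF state]] by auto
    then have sy: "shifted y = \<pi> y" using False by (simp add: shifted_def)
    show ?thesis
    proof (cases "\<pi> y = \<pi> v")
      case True
      then have "fan_step shifted M v y" using missing_shifted_end y sy by (simp add: fan_step_def)
      then show ?thesis by blast
    next
      case False
      then have "fan_step shifted M x y" using missing_shifted y sy by (simp add: fan_step_def)
      then show ?thesis using step.IH by (meson rtranclp.rtrancl_into_rtrancl)
    qed
  qed simp
qed

lemma shifted_image_M: "c \<in> colors \<Longrightarrow> c \<in> shifted ` M \<Longrightarrow> c \<in> \<pi> ` M"
  using step_facts(1) by (auto simp: shifted_def split: if_splits)

end

section \<open>Colours missing along a fan\<close>

text \<open>Shift along the fan until \<open>e\<close> is uncoloured, where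
  \<open>missing_color\<close> applies. A missing colour survives each shift unless it is the colour
  of \<open>v\<close>, which occurs on \<open>M\<close> anyway.\<close>

lemma missing_subset_center:
  assumes "state \<pi> u M" "fan \<pi> M u e cs" "c \<in> missing \<pi> M e"
  shows "c \<in> \<pi> ` M"
  using assms
proof (induction cs arbitrary: \<pi> u)
  case Nil
  then show ?case using missing_color by (auto elim: fan_NilE)
next
  case (Cons c0 cs)
  from Cons.prems(2) obtain v where v: "fan_step \<pi> M u v" "c0 = \<pi> v" "fan \<pi> M v e cs" "c0 \<notin> set cs"
    by (auto elim: fan_ConsE)
  show ?case
  proof (cases "c = c0")
    case True
    then show ?thesis using v by (simp add: fan_step_def)
  next
    case False
    have "c \<in> shifted \<pi> u v ` M"
      using Cons.IH[OF shifted_state[OF Cons.prems(1) v(1)] fan_shifted[OF Cons.prems(1) v(1,3)]]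
        missing_shifted[OF Cons.prems(1) v(1) Cons.prems(3)] v(2,4) False by simp
    then show ?thesis
      using shifted_image_M[OF Cons.prems(1) v(1)] Cons.prems(3) by (simp add: missing_def)
  qed
qed

lemma reachable_missing_subset:
  assumes "state \<pi> u M" "(fan_step \<pi> M)\<^sup>*\<^sup>* u e"
  shows "missing \<pi> M e \<subseteq> \<pi> ` M"
  using missing_subset_center[OF assms(1)] fan_if_reachable[OF assms(2)] by blast

lemma reachable_outer_exists:
  assumes "state \<pi> u M" "(fan_step \<pi> M)\<^sup>*\<^sup>* u e"
  shows "\<exists>N. tight \<pi> N \<and> e \<in> N \<and> \<not> N \<subseteq> M"
proof -
  note s = stateD[OF assms(1)]
  obtain a where "a \<in> colors" "a \<notin> \<pi> ` M" using free_color[OF s(2,1,6,5)] by blast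
  then have "a \<notin> missing \<pi> M e" using reachable_missing_subset[OF assms] by blast
  then show ?thesis using \<open>a \<in> colors\<close> by (auto simp: missing_def)
qed

lemma missing_outer:
  assumes "state \<pi> u M" "e \<in> M" "tight \<pi> N" "e \<in> N" "\<not> N \<subseteq> M"
  shows "missing \<pi> M e = colors - \<pi> ` N"
  using outer_unique[OF stateD(3,4)[OF assms(1)] assms(2-5)] assms(3-5)
  unfolding missing_def by blast

lemma state_outer:
  assumes "state \<pi> u M" "tight \<pi> N" "u \<in> N" "\<not> N \<subseteq> M"
  shows "state \<pi> u N" "\<not> M \<subseteq> N"
proof -
  note s = stateD[OF assms(1)]
  show "state \<pi> u N" using s outer_maxtight[OF s(3,4,5) assms(2-4)] assms(3) by (simp add: state_def)
  show "\<not> M \<subseteq> N" using s(4) assms(2,4) unfolding maxtight_def by blast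
qed

lemma not_uncross_outer:
  assumes "valid \<pi>" "maxtight \<pi> M" "tight \<pi> N" "\<not> N \<subseteq> M"
  shows "\<not> uncross M N"
  using maxtight_uncross_subset assms by blast

section \<open>Exchanges of two colours around the uncoloured element\<close>

text \<open>This controls the sets through \<open>u\<close> that an exchange of \<open>a\<close> and
  \<open>b\<close> makes tight. As \<open>M\<close> and \<open>N\<close> do not uncross,
  \<open>M\<close> and \<open>Z\<close> do. Because of \<open>a\<close> their union is not tight,
  which uses up the surplus of \<open>Z\<close>; hence \<open>Z \<inter> M\<close> is tight, has
  \<open>b\<close>, is not inside \<open>N\<close>, and so equals \<open>M\<close>.\<close>

lemma almost_tight_superset:
  assumes "state \<pi> u M" "tight \<pi> N" "u \<in> N" "\<not> N \<subseteq> M"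
    and "b \<in> colors" "a \<notin> \<pi> ` M" "b \<notin> \<pi> ` N"
    and Z: "Z \<in> F" "u \<in> Z" "int (card (\<pi> ` Z)) = g Z + 1" "a \<in> \<pi> ` Z" "b \<in> \<pi> ` Z"
  shows "M \<subseteq> Z"
proof -
  note s = stateD[OF assms(1)]
  have FM: "M \<in> F" "N \<in> F" using s(6) assms(2) tight_F by auto
  have ne: "M \<noteq> N" "N \<noteq> Z" "M \<noteq> Z" using assms(4,6,7) Z(4,5) by blast+
  have unc: "uncross M Z"
    using two_thirds(1)[OF FM Z(1) ne s(5) assms(3) Z(2) not_uncross_outer[OF s(3,4) assms(2,4)]] .
  have FZ: "Z \<union> M \<in> F" "Z \<inter> M \<in> F" "g Z + g M \<le> g (Z \<union> M) + g (Z \<inter> M)"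
    using unc by (auto simp: uncross_def Un_commute Int_commute)
  \<comment> \<open>The set blocking \<open>b\<close> at \<open>u\<close> cannot lie inside
    \<open>N\<close>, which lacks \<open>b\<close>, so it is \<open>M\<close>.\<close>
  obtain X where X: "tight \<pi> X" "u \<in> X" "b \<in> \<pi> ` X"
    using color_blocked[OF s(2,1,3) assms(5)] by blast
  then have "X = M" using inner_subset[OF assms(1-4) X(1,2)] assms(7) by blast
  then have bM: "b \<in> \<pi> ` M" using X by simp
  have notU: "\<not> tight \<pi> (Z \<union> M)"
  proof
    assume "tight \<pi> (Z \<union> M)"
    then have "Z \<union> M = M" using s(4) by (simp add: maxtight_def)
    then show False using Z(4) assms(6) by blast
  qed
  have v: "g (Z \<union> M) < int (card (\<pi> ` (Z \<union> M)))" "g (Z \<inter> M) \<le> int (card (\<pi> ` (Z \<inter> M)))"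
    using s(3) FZ notU by (auto simp: valid_def tight_def order_less_le)
  have c: "card (\<pi> ` (Z \<union> M)) + card (\<pi> ` Z \<inter> \<pi> ` M) = card (\<pi> ` Z) + card (\<pi> ` M)"
    by (rule card_image_Un_Int[OF Z(1) FM(1)])
  have tM: "int (card (\<pi> ` M)) = g M" using s(6) by (simp add: tight_def)
  have "b \<in> \<pi> ` (Z \<inter> M)"
  proof (rule ccontr)
    assume "b \<notin> \<pi> ` (Z \<inter> M)"
    then have "\<pi> ` (Z \<inter> M) \<subset> \<pi> ` Z \<inter> \<pi> ` M" using bM Z(5) by blast
    then have "card (\<pi> ` (Z \<inter> M)) < card (\<pi> ` Z \<inter> \<pi> ` M)"
      using finite_F[OF Z(1)] by (intro psubset_card_mono) auto
    then show False using v c tM FZ(3) Z(3) by linarith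
  qed
  moreover have "tight \<pi> (Z \<inter> M)"
    using v c tM FZ(2,3) Z(3) card_image_Int_le[OF Z(1), of \<pi> M] unfolding tight_def by linarith
  ultimately have "Z \<inter> M = M"
    using inner_subset[OF assms(1-4), of "Z \<inter> M"] assms(7) Z(2) s(5) by blast
  then show ?thesis by blast
qed

lemma swap_coloring:
  assumes "coloring \<pi> E" "a \<in> colors" "b \<in> colors"
  shows "coloring (swap_colors a b C \<pi>) E"
  unfolding coloring_def
proof
  fix x assume "x \<in> U"
  then have x: "if x \<in> E then \<pi> x \<in> colors else \<pi> x = Inr x"
    using assms(1) unfolding coloring_def by blast
  have "swap_colors a b C \<pi> x \<in> colors" if "\<pi> x \<in> colors"
    using swap_colors_cases[of a b C \<pi> x] that assms(2,3) by auto
  moreover have "swap_colors a b C \<pi> x = \<pi> x" if "\<pi> x = Inr x"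
    using swap_colors_cases[of a b C \<pi> x] that assms(2,3) by auto
  ultimately show "if x \<in> E then swap_colors a b C \<pi> x \<in> colors else swap_colors a b C \<pi> x = Inr x"
    using x by metis
qed

lemma swap_tight_both:
  assumes "tight \<pi> X" "tight (swap_colors a b C \<pi>) X" "a \<notin> \<pi> ` X \<or> b \<notin> \<pi> ` X"
  shows "\<not> (a \<in> swap_colors a b C \<pi> ` X \<and> b \<in> swap_colors a b C \<pi> ` X)"
proof
  assume "a \<in> swap_colors a b C \<pi> ` X \<and> b \<in> swap_colors a b C \<pi> ` X"
  then have "card (\<pi> ` X) < card (swap_colors a b C \<pi> ` X)"
    using recolor_card_greater[of X "swap_colors a b C \<pi>" \<pi> a b] tight_F[OF assms(1)]
      swap_colors_cases[of a b C \<pi>] assms(3) by presburger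
  then show False using assms(1,2) by (simp add: tight_def)
qed

text \<open>Vizing's chain argument: otherwise, exchanging the two colours on the component of
  \<open>x\<close> would leave no tight set that blocks \<open>a\<close> at
  \<open>u\<close>.\<close>

lemma kempe_connected:
  assumes st: "state \<pi> u M" and N: "tight \<pi> N" "u \<in> N" "\<not> N \<subseteq> M"
    and ab: "a \<in> colors" "b \<in> colors" "a \<notin> \<pi> ` M" "b \<notin> \<pi> ` N"
    and x: "x \<in> N" "\<pi> x = a" and y: "y \<in> M" "\<pi> y = b"
  shows "(kadj \<pi> a b)\<^sup>*\<^sup>* x y"
proof (rule ccontr)
  assume not: "\<not> ?thesis"
  note s = stateD[OF st]
  define C where "C = {z. (kadj \<pi> a b)\<^sup>*\<^sup>* x z}"
  have closed: "w \<in> C" if "kadj \<pi> a b v w" "v \<in> C" for v w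
    using that unfolding C_def by (auto intro: rtranclp.rtrancl_into_rtrancl)
  let ?\<pi> = "swap_colors a b C \<pi>"
  have px: "?\<pi> x = b" using x by (simp add: swap_colors_def C_def)
  have py: "?\<pi> y = b" using y not by (simp add: swap_colors_def C_def)
  have v': "valid ?\<pi>" by (rule swap_valid[OF s(3)]) (use closed in blast)
  obtain X where X: "tight ?\<pi> X" "u \<in> X" "a \<in> ?\<pi> ` X"
    using color_blocked[OF swap_coloring[OF s(2) ab(1,2)] s(1) v' ab(1)] by blast
  show False
  proof (cases "tight \<pi> X")
    case False
    note n = swap_tight_new[OF s(3) X(1) False]
    \<comment> \<open>A newly tight set contains \<open>M\<close> and hence \<open>y\<close>, which
      still has colour \<open>b\<close>; together with \<open>a\<close> it would have both
      colours.\<close>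
    have "M \<subseteq> X"
      using almost_tight_superset[OF st N ab(2,3,4) tight_F[OF X(1)] X(2) n(3,1,2)] .
    from subsetD[OF this y(1)] py[symmetric] have "b \<in> ?\<pi> ` X" by (rule rev_image_eqI)
    then show False using n(4) X(3) by simp
  next
    case True
    note both = swap_tight_both[OF True X(1)]
    have "X = M \<or> X = N \<or> X \<subseteq> M \<and> X \<subseteq> N"
      using inner_subset[OF st N True X(2)]
        inner_subset[OF state_outer(1)[OF st N] s(6,5) state_outer(2)[OF st N] True X(2)] by argo
    then consider "X = M" | "X = N" | "X \<subseteq> M" "X \<subseteq> N" by argo
    then show False
    proof cases
      case 1
      from y(1) py[symmetric] have "b \<in> ?\<pi> ` M" by (rule rev_image_eqI)
      then show False using both[unfolded 1] ab(3) X(3)[unfolded 1] by simp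
    next
      case 2
      from x(1) px[symmetric] have "b \<in> ?\<pi> ` N" by (rule rev_image_eqI)
      then show False using both[unfolded 2] ab(4) X(3)[unfolded 2] by simp
    next
      case 3
      from X(3) obtain z where z: "a = ?\<pi> z" "z \<in> X" by (rule imageE)
      have "\<pi> z \<notin> {a, b}" using z(2) 3 ab(3,4) by blast
      then show False using z(1) swap_colors_cases[of a b C \<pi> z] by (metis insertI1)
    qed
  qed
qed

section \<open>Disjointness of the missing colours\<close>

text \<open>Take a colour \<open>a\<close> absent from \<open>M\<close>. The chain of
  \<open>a\<close> and \<open>b\<close> from \<open>N\<close> ends in \<open>M\<close>, so the one
  from \<open>Nf\<close> is different. Exchanging along the latter leaves \<open>M\<close> unchanged
  and preserves reachability, but gives \<open>Nf\<close> the colour \<open>b\<close> in addition to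
  \<open>a\<close>.\<close>

lemma missing_disjoint_base:
  assumes st: "state \<pi> u M" and N: "tight \<pi> N" "u \<in> N" "\<not> N \<subseteq> M"
    and f: "(fan_step \<pi> M)\<^sup>*\<^sup>* u f" and Nf: "tight \<pi> Nf" "f \<in> Nf" "\<not> Nf \<subseteq> M"
    and b: "b \<in> missing \<pi> M u" "b \<in> missing \<pi> M f"
  shows "Nf = N"
proof (rule ccontr)
  assume ne: "Nf \<noteq> N"
  note s = stateD[OF st]
  have fM: "f \<in> M" using reachable_in[OF f s(5)] .
  obtain a where a: "a \<in> colors" "a \<notin> \<pi> ` M" using free_color[OF s(2,1,6,5)] by blast
  have bc: "b \<in> colors" using b by (simp add: missing_def)
  have bN: "b \<notin> \<pi> ` N" and bNf: "b \<notin> \<pi> ` Nf" using b N Nf by (auto simp: missing_def)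
  have aN: "a \<in> \<pi> ` N"
    using missing_outer[OF st s(5) N] missing_color[OF st, of a] a by blast
  have aNf: "a \<in> \<pi> ` Nf"
    using missing_outer[OF st fM Nf] reachable_missing_subset[OF st f] a by blast
  obtain x where x: "x \<in> N" "\<pi> x = a" using aN by blast
  obtain x' where x': "x' \<in> Nf" "\<pi> x' = a" using aNf by blast
  obtain y where y: "y \<in> M" "\<pi> y = b" using missing_color[OF st b(1)] by blast
  have ab: "a \<noteq> b" using y a by auto
  have mN: "maxtight \<pi> N" using outer_maxtight[OF s(3,4,5) N] .
  have mNf: "maxtight \<pi> Nf" using outer_maxtight[OF s(3,4) fM Nf] .
  let ?R = "kadj \<pi> a b"
  have conn: "?R\<^sup>*\<^sup>* v w" if "v \<in> N" "\<pi> v = a" "w \<in> M" "\<pi> w = b" for v w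
    using kempe_connected[OF st N a(1) bc a(2) bN that] .
  have sym: "?R\<^sup>*\<^sup>* w v" if "?R\<^sup>*\<^sup>* v w" for v w
    using that kadj_sym[of \<pi> a b] by (metis sympD sympI symp_rtranclp)
  have apart: "\<not> ?R\<^sup>*\<^sup>* x x'"
  proof
    assume xx': "?R\<^sup>*\<^sup>* x x'"
    \<comment> \<open>All three elements have degree at most one, while a component has at most two
      ends.\<close>
    have "x' = x \<or> x' = y"
    proof (rule deg2_component_ends[of ?R x y x'])
      show "?R x w1 \<Longrightarrow> ?R x w2 \<Longrightarrow> w1 = w2" for w1 w2
        using kadj_deg1[OF s(3) ab mN x(1)] bN by blast
      show "?R y w1 \<Longrightarrow> ?R y w2 \<Longrightarrow> w1 = w2" for w1 w2
        using kadj_deg1[OF s(3) ab s(4) y(1)] a(2) by blast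
      show "?R x' w1 \<Longrightarrow> ?R x' w2 \<Longrightarrow> w1 = w2" for w1 w2
        using kadj_deg1[OF s(3) ab mNf x'(1)] bNf by blast
    qed (use kadj_sym[of \<pi> a b] kadj_deg2[OF s(3) ab] conn[OF x y] xx' x y ab in blast)+
    then have "x' = x" using x'(2) y(2) ab by metis
    \<comment> \<open>If \<open>x'\<close> equals \<open>x\<close>, the first edge of the chain
      comes from a tight set through \<open>x\<close> that has \<open>b\<close> and so is not inside
      \<open>N\<close>; this can only be \<open>Nf\<close>, which lacks \<open>b\<close>.\<close>
    have "x \<noteq> y" using x(2) y(2) ab by metis
    then obtain w where "?R x w" using conn[OF x y] by (meson converse_rtranclpE)
    then obtain X where X: "mindouble \<pi> a b X" "x \<in> X" using kadjD[OF _ ab] by blast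
    then have tX: "tight \<pi> X" "b \<in> \<pi> ` X" by (auto simp: mindouble_def double_def)
    have "\<not> X \<subseteq> N" using tX(2) bN by blast
    moreover have "\<not> Nf \<subseteq> N" using mNf N(1) ne unfolding maxtight_def by blast
    ultimately have "X = Nf"
      using outer_unique[OF s(3) mN x(1) tX(1) X(2) _ Nf(1)] x'(1) \<open>x' = x\<close> by blast
    then show False using tX(2) bNf by blast
  qed
  define C where "C = {z. ?R\<^sup>*\<^sup>* x' z}"
  have closed: "w \<in> C" if "kadj \<pi> a b v w" "v \<in> C" for v w
    using that unfolding C_def by (auto intro: rtranclp.rtrancl_into_rtrancl)
  let ?\<pi> = "swap_colors a b C \<pi>"
  have same: "?\<pi> z = \<pi> z" if "\<pi> z \<in> {a, b} \<Longrightarrow> ?R\<^sup>*\<^sup>* x z" for z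
  proof (cases "\<pi> z \<in> {a, b}")
    case True
    have "z \<notin> C"
      using apart rtranclp_trans[OF that[OF True] sym] unfolding C_def by blast
    then show ?thesis by (simp add: swap_colors_def)
  qed (use swap_colors_cases[of a b C \<pi> z] in blast)
  have sameM: "?\<pi> z = \<pi> z" if "z \<in> M" for z
    using same[of z] conn[OF x that] that a(2) by blast
  have samex: "?\<pi> x = a" using same[of x] x by simp
  have imM: "?\<pi> ` M = \<pi> ` M" using sameM by (intro image_cong) auto
  have v': "valid ?\<pi>" by (rule swap_valid[OF s(3)]) (use closed in blast)
  have m': "maxtight ?\<pi> M"
    unfolding maxtight_def
  proof (intro conjI allI impI)
    show "tight ?\<pi> M" using s(6) imM by (simp add: tight_def)
  next
    fix X assume X: "tight ?\<pi> X" "M \<subseteq> X"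
    show "X = M"
    proof (cases "tight \<pi> X")
      case True
      then show ?thesis using s(4) X(2) by (simp add: maxtight_def)
    next
      case False
      note n = swap_tight_new[OF s(3) X(1) False]
      have uX: "u \<in> X" using X(2) s(5) by blast
      \<comment> \<open>This is \<open>almost_tight_superset\<close> with \<open>M\<close> and
        \<open>N\<close>, and also the two colours, interchanged; it puts \<open>x\<close> and thus
        the colour \<open>a\<close> into \<open>X\<close>.\<close>
      have "N \<subseteq> X"
        using almost_tight_superset[OF state_outer(1)[OF st N] s(6,5) state_outer(2)[OF st N]
            a(1) bN a(2) tight_F[OF X(1)] uX n(3,2,1)] .
      from subsetD[OF this x(1)] samex[symmetric] have "a \<in> ?\<pi> ` X" by (rule rev_image_eqI)
      moreover have "?\<pi> y = b" using y sameM by simp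
      from subsetD[OF X(2) y(1)] this[symmetric] have "b \<in> ?\<pi> ` X" by (rule rev_image_eqI)
      ultimately show ?thesis using n(4) by simp
    qed
  qed
  have st': "state ?\<pi> u M"
    using s(1,5) swap_coloring[OF s(2) a(1) bc] v' m' by (simp add: state_def)
  have t': "tight \<pi> X"
    if e: "(fan_step \<pi> M)\<^sup>*\<^sup>* u e" and X: "tight ?\<pi> X" "e \<in> X" "\<not> X \<subseteq> M" for e X
  proof (rule ccontr)
    assume nt: "\<not> tight \<pi> X"
    obtain Ne where Ne: "tight \<pi> Ne" "e \<in> Ne" "\<not> Ne \<subseteq> M" using reachable_outer_exists[OF st e] by blast
    \<comment> \<open>\<open>M\<close> does not uncross with the old outer set at \<open>e\<close>,
      so it uncrosses with a newly tight one, against the maximality of \<open>M\<close> after the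
      exchange.\<close>
    have "M \<noteq> Ne" "Ne \<noteq> X" "M \<noteq> X" using Ne X nt by auto
    then have "uncross M X"
      using two_thirds(1)[OF tight_F[OF s(6)] tight_F[OF Ne(1)] tight_F[OF X(1)] _ _ _
          reachable_in[OF e s(5)] Ne(2) X(2) not_uncross_outer[OF s(3,4) Ne(1,3)]] by blast
    then show False using not_uncross_outer[OF v' m' X(1,3)] by blast
  qed
  have aX: "a \<in> ?\<pi> ` X"
    if "(fan_step ?\<pi> M)\<^sup>*\<^sup>* u e" "tight ?\<pi> X" "e \<in> X" "\<not> X \<subseteq> M" for e X
  proof -
    have "a \<notin> missing ?\<pi> M e" using reachable_missing_subset[OF st' that(1)] a(2) imM by (metis subsetD)
    then show ?thesis
      using missing_outer[OF st' reachable_in[OF that(1) s(5)] that(2-4)] a(1) by (metis DiffI)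
  qed
  have reach: "(fan_step ?\<pi> M)\<^sup>*\<^sup>* u e" if "(fan_step \<pi> M)\<^sup>*\<^sup>* u e" for e
    using that
  proof (induction rule: rtranclp_induct)
    case (step e w)
    have w: "w \<in> M" "\<pi> w \<in> missing \<pi> M e" using step.hyps(2) by (auto simp: fan_step_def)
    have wa: "\<pi> w \<noteq> a" using w(1) a(2) by blast
    \<comment> \<open>The only colour that could get in the way is a newly gained \<open>b\<close>.
      But \<open>X\<close> also has \<open>a\<close> after the exchange, so its count would have
      grown although it is tight both times.\<close>
    have "\<pi> w \<notin> ?\<pi> ` X" if X: "tight ?\<pi> X" "e \<in> X" "\<not> X \<subseteq> M" for X
    proof
      assume wX: "\<pi> w \<in> ?\<pi> ` X"
      have t: "tight \<pi> X" using t'[OF step.hyps(1) X] .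
      have nw: "\<pi> w \<notin> \<pi> ` X" using w(2) t X by (auto simp: missing_def)
      obtain z where z: "z \<in> X" "\<pi> w = ?\<pi> z" using wX by blast
      then have "?\<pi> z \<noteq> \<pi> z" using nw by auto
      then have "\<pi> w = b" using swap_colors_cases[of a b C \<pi> z] z wa by auto
      then show False
        using swap_tight_both[OF t X(1)] aX[OF step.IH X] nw wX by metis
    qed
    then have "\<pi> w \<in> missing ?\<pi> M e" using w(2) by (simp add: missing_def)
    then have "fan_step ?\<pi> M e w" using w(1) sameM by (simp add: fan_step_def)
    then show ?case using step.IH by (meson rtranclp.rtrancl_into_rtrancl)
  qed simp
  obtain X where X: "tight ?\<pi> X" "f \<in> X" "\<not> X \<subseteq> M"
    using reachable_outer_exists[OF st' reach[OF f]] by blast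
  have t: "tight \<pi> X" using t'[OF f X] .
  have "X = Nf" using outer_unique[OF s(3,4) fM t X(2,3) Nf] .
  moreover have "?\<pi> x' = b" using x' by (simp add: swap_colors_def C_def)
  ultimately have "b \<in> ?\<pi> ` X" using x'(1) by (intro rev_image_eqI[of x']) auto
  then show False
    using swap_tight_both[OF t X(1)] aX[OF reach[OF f] X] bNf \<open>X = Nf\<close> by metis
qed

text \<open>Some tight set through \<open>e\<close> not inside \<open>M\<close> exists after the
  shift; it was tight before, so by uniqueness it is \<open>N\<close>.\<close>

lemma shifted_outer:
  assumes st: "state \<pi> u M" and v: "fan_step \<pi> M u v" and e: "(fan_step \<pi> M)\<^sup>*\<^sup>* u e"
    and N: "tight \<pi> N" "e \<in> N" "\<not> N \<subseteq> M"
  shows "tight (shifted \<pi> u v) N"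
proof -
  note s = stateD[OF st]
  obtain X where X: "tight (shifted \<pi> u v) X" "e \<in> X" "\<not> X \<subseteq> M"
    using reachable_outer_exists[OF shifted_state[OF st v] reachable_shifted[OF st v e]] by blast
  have "X = N"
    using outer_unique[OF s(3,4) reachable_in[OF e s(5)] shifted_tight[OF st v X(1,3)] X(2,3) N] .
  then show ?thesis using X by simp
qed

lemma fan_reachable: "fan \<pi> M v e cs \<Longrightarrow> (fan_step \<pi> M)\<^sup>*\<^sup>* v e"
  by (induction rule: fan.induct) (auto intro: converse_rtranclp_into_rtranclp)

text \<open>Shift along the fan towards \<open>e\<close>, keeping \<open>c\<close> missing at
  \<open>e\<close> and \<open>f\<close>. If \<open>c\<close> is the colour of the next fan element,
  it is missing at \<open>u\<close> already, and the base case identifies both sets with the outer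
  set at \<open>u\<close>.\<close>

lemma missing_disjoint:
  assumes "state \<pi> u M" "fan \<pi> M u e cs" "(fan_step \<pi> M)\<^sup>*\<^sup>* u f"
    and "tight \<pi> Ne" "e \<in> Ne" "\<not> Ne \<subseteq> M" and "tight \<pi> Nf" "f \<in> Nf" "\<not> Nf \<subseteq> M"
    and "c \<in> missing \<pi> M e" "c \<in> missing \<pi> M f"
  shows "Ne = Nf"
  using assms
proof (induction cs arbitrary: \<pi> u)
  case Nil
  then have "e = u" by (auto elim: fan_NilE)
  then show ?case using missing_disjoint_base[of \<pi> u M Ne f Nf c] Nil by blast
next
  case (Cons c0 cs)
  note st = Cons.prems(1)
  from Cons.prems(2) obtain v where v: "fan_step \<pi> M u v" "c0 = \<pi> v" "fan \<pi> M v e cs" "c0 \<notin> set cs"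
    by (auto elim: fan_ConsE)
  have e: "(fan_step \<pi> M)\<^sup>*\<^sup>* u e" using fan_reachable[OF Cons.prems(2)] .
  show ?case
  proof (cases "c = c0")
    case True
    then have cu: "c \<in> missing \<pi> M u" using v by (simp add: fan_step_def)
    obtain N where N: "tight \<pi> N" "u \<in> N" "\<not> N \<subseteq> M" using outer_exists[OF st] by blast
    show ?thesis
      using missing_disjoint_base[OF st N e Cons.prems(4-6) cu Cons.prems(10)]
        missing_disjoint_base[OF st N Cons.prems(3,7-9) cu Cons.prems(11)] by simp
  next
    case False
    show ?thesis
    proof (rule Cons.IH[OF shifted_state[OF st v(1)]])
      show "fan (shifted \<pi> u v) M v e cs" using fan_shifted[OF st v(1,3)] v by simp
      show "(fan_step (shifted \<pi> u v) M)\<^sup>*\<^sup>* v f"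
        using reachable_shifted[OF st v(1) Cons.prems(3)] .
      show "tight (shifted \<pi> u v) Ne" using shifted_outer[OF st v(1) e Cons.prems(4-6)] .
      show "tight (shifted \<pi> u v) Nf" using shifted_outer[OF st v(1) Cons.prems(3,7-9)] .
      show "c \<in> missing (shifted \<pi> u v) M e" "c \<in> missing (shifted \<pi> u v) M f"
        using missing_shifted[OF st v(1)] Cons.prems(10,11) False v(2) by blast+
    qed (use Cons.prems in blast)+
  qed
qed

section \<open>Counting the missing colours\<close>

text \<open>Otherwise each outer set \<open>N\<close> of a reached element misses at least
  \<open>card (N \<inter> M)\<close> colours. These colours are disjoint for different
  \<open>N\<close> and occur on reached elements other than \<open>u\<close>, so they are fewer than
  the reached elements; but the sets \<open>N \<inter> M\<close> cover all of those.\<close>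

lemma reachable_outer_crowded:
  assumes st: "state \<pi> u M"
  shows "\<exists>e N. (fan_step \<pi> M)\<^sup>*\<^sup>* u e \<and> tight \<pi> N \<and> e \<in> N \<and> \<not> N \<subseteq> M \<and>
    int k < g N + int (card (N \<inter> M))"
proof (rule ccontr)
  assume "\<not> ?thesis"
  then have room: "g N + int (card (N \<inter> M)) \<le> int k"
    if "(fan_step \<pi> M)\<^sup>*\<^sup>* u e" "tight \<pi> N" "e \<in> N" "\<not> N \<subseteq> M" for e N
    using that not_le by blast
  note s = stateD[OF st]
  define R where "R = {e. (fan_step \<pi> M)\<^sup>*\<^sup>* u e}"
  define \<N> where "\<N> = {N. \<exists>e\<in>R. tight \<pi> N \<and> e \<in> N \<and> \<not> N \<subseteq> M}"
  have RM: "R \<subseteq> M" using reachable_in s(5) by (auto simp: R_def)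
  have finM: "finite M" using finite_F tight_F s(6) by blast
  have finR: "finite R" using RM finM finite_subset by blast
  have finN: "finite \<N>"
    using F_subset finite_U by (rule_tac finite_subset[of _ "Pow U"]) (auto simp: tight_def \<N>_def)
  let ?m = "\<lambda>N. colors - \<pi> ` N"
  have m: "?m N = missing \<pi> M e" if "e \<in> R" "tight \<pi> N" "e \<in> N" "\<not> N \<subseteq> M" for e N
    using missing_outer[OF st _ that(2-4)] RM that(1) by blast
  have card_m: "card (N \<inter> M) \<le> card (?m N)" if N: "N \<in> \<N>" for N
  proof -
    obtain e where e: "e \<in> R" "tight \<pi> N" "e \<in> N" "\<not> N \<subseteq> M" using N unfolding \<N>_def by blast
    have "finite (\<pi> ` N)" using finite_F tight_F e(2) by blast
    then have "card colors - card (\<pi> ` N) \<le> card (?m N)" by (rule diff_card_le_card_Diff)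
    moreover have "card colors = k" by (simp add: card_image)
    ultimately show ?thesis
      using room[of e N] e unfolding R_def tight_def by auto
  qed
  have disj: "?m N \<inter> ?m N' = {}" if N: "N \<in> \<N>" "N' \<in> \<N>" "N \<noteq> N'" for N N'
  proof -
    obtain e where e: "e \<in> R" "tight \<pi> N" "e \<in> N" "\<not> N \<subseteq> M" using N(1) unfolding \<N>_def by blast
    obtain f where f: "f \<in> R" "tight \<pi> N'" "f \<in> N'" "\<not> N' \<subseteq> M" using N(2) unfolding \<N>_def by blast
    have reach: "(fan_step \<pi> M)\<^sup>*\<^sup>* u e" "(fan_step \<pi> M)\<^sup>*\<^sup>* u f"
      using e(1) f(1) by (simp_all add: R_def)
    obtain cs where cs: "fan \<pi> M u e cs" using fan_if_reachable[OF reach(1)] by blast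
    show ?thesis
      using missing_disjoint[OF st cs reach(2) e(2-4) f(2-4)] N(3) unfolding m[OF e] m[OF f]
      by blast
  qed
  have "(\<Union>N\<in>\<N>. ?m N) \<subseteq> \<pi> ` (R - {u})"
  proof
    fix c assume "c \<in> (\<Union>N\<in>\<N>. ?m N)"
    then obtain N e where c: "c \<in> ?m N" and e: "e \<in> R" "tight \<pi> N" "e \<in> N" "\<not> N \<subseteq> M"
      by (auto simp: \<N>_def)
    have ce: "c \<in> missing \<pi> M e" using c unfolding m[OF e] .
    have ue: "(fan_step \<pi> M)\<^sup>*\<^sup>* u e" using e(1) by (simp add: R_def)
    obtain w where w: "w \<in> M" "c = \<pi> w" using reachable_missing_subset[OF st ue] ce by blast
    then have "fan_step \<pi> M e w" using ce by (simp add: fan_step_def)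
    then have "w \<in> R" using ue unfolding R_def by (auto intro: rtranclp.rtrancl_into_rtrancl)
    moreover have "w \<noteq> u" using c w(2) uncolored(1)[OF s(2,1)] by auto
    ultimately show "c \<in> \<pi> ` (R - {u})" using w(2) by blast
  qed
  then have "card (\<Union>N\<in>\<N>. ?m N) \<le> card (R - {u})"
    using finR by (meson card_image_le card_mono finite_Diff finite_imageI le_trans)
  \<comment> \<open>The strict inequality of the count comes from \<open>u\<close>, which is reached
    but has no proper colour.\<close>
  also have "\<dots> < card R"
    using finR by (intro psubset_card_mono) (auto simp: R_def)
  also have "R \<subseteq> (\<Union>N\<in>\<N>. N \<inter> M)"
  proof
    fix e assume e: "e \<in> R"
    then have "(fan_step \<pi> M)\<^sup>*\<^sup>* u e" by (simp add: R_def)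
    from reachable_outer_exists[OF st this] obtain N
      where "tight \<pi> N" "e \<in> N" "\<not> N \<subseteq> M" by blast
    then show "e \<in> (\<Union>N\<in>\<N>. N \<inter> M)" using e RM by (auto simp: \<N>_def)
  qed
  then have "card R \<le> card (\<Union>N\<in>\<N>. N \<inter> M)" using finM finN by (intro card_mono) auto
  also have "\<dots> \<le> (\<Sum>N\<in>\<N>. card (N \<inter> M))" using finN by (rule card_UN_le)
  also have "\<dots> \<le> (\<Sum>N\<in>\<N>. card (?m N))" using card_m by (rule sum_mono)
  also have "\<dots> = card (\<Union>N\<in>\<N>. ?m N)"
    using finN disj by (intro card_UN_disjoint[symmetric]) auto
  finally show False by simp
qed

section \<open>Contradiction to the \<open>g\<close>-laminarity hypothesis\<close>

context
  assumes laminar: "g_laminar F g {X \<in> F. g X + int (max_crossing F X) > int k}"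
begin

text \<open>The two sets cross and belong to the \<open>g\<close>-laminar family, so they would
  uncross, against the maximality of \<open>M\<close>.\<close>

lemma no_heavy_pair:
  assumes "valid \<pi>" "maxtight \<pi> M" "tight \<pi> N" "e \<in> M" "e \<in> N" "\<not> N \<subseteq> M"
    and "g M + int (max_crossing F M) > int k" "g N + int (max_crossing F N) > int k"
  shows False
proof -
  have F: "M \<in> F" "N \<in> F" using assms(2,3) maxtight_tight tight_F by blast+
  then have "M - N = {} \<or> N - M = {} \<or> M \<inter> N = {} \<or> uncross M N"
    using laminar assms(7,8) unfolding g_laminar_def uncross_def by blast
  moreover have "\<not> M \<subseteq> N" using assms(2,3,6) unfolding maxtight_def by blast
  ultimately show False
    using not_uncross_outer[OF assms(1-3,6)] assms(4-6) by blast
qed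

lemma card_Int_le_max_crossing:
  assumes "N \<in> F" "M \<in> F" "\<not> N \<subseteq> M" "\<not> M \<subseteq> N"
  shows "card (N \<inter> M) \<le> max_crossing F N"
proof -
  let ?S = "{card (N \<inter> Y) | Y. Y = {} \<or> (Y \<in> F \<and> \<not> N \<subseteq> Y \<and> \<not> Y \<subseteq> N)}"
  have "?S \<subseteq> {..card N}" using finite_F[OF assms(1)] by (auto intro: card_mono)
  then have "finite ?S" using finite_subset by blast
  moreover have "card (N \<inter> M) \<in> ?S" using assms by blast
  ultimately show ?thesis unfolding max_crossing_def by (rule Max_ge)
qed

lemma reachable_outer_heavy:
  assumes "state \<pi> u M"
  shows "\<exists>e N. (fan_step \<pi> M)\<^sup>*\<^sup>* u e \<and> tight \<pi> N \<and> e \<in> N \<and> \<not> N \<subseteq> M \<and>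
    int k < g N + int (max_crossing F N)"
proof -
  note s = stateD[OF assms]
  obtain e N where e: "(fan_step \<pi> M)\<^sup>*\<^sup>* u e"
    and N: "tight \<pi> N" "e \<in> N" "\<not> N \<subseteq> M" "int k < g N + int (card (N \<inter> M))"
    using reachable_outer_crowded[OF assms] by blast
  have "\<not> M \<subseteq> N" using s(4) N(1,3) unfolding maxtight_def by blast
  then have "card (N \<inter> M) \<le> max_crossing F N"
    using card_Int_le_max_crossing N tight_F s(6) by blast
  then show ?thesis using e N by (intro exI[of _ e] exI[of _ N]) auto
qed

text \<open>Shifting along the fan keeps \<open>N\<close> tight and moves the uncoloured element to
  \<open>e\<close>, which leaves the case of the empty fan.\<close>

lemma no_heavy_outer:
  assumes "state \<pi> u M" "fan \<pi> M u e cs" "tight \<pi> N" "e \<in> N" "\<not> N \<subseteq> M"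
    and heavy: "int k < g N + int (max_crossing F N)"
  shows False
  using assms(1-5)
proof (induction cs arbitrary: \<pi> u)
  case Nil
  then have "e = u" by (auto elim: fan_NilE)
  text \<open>\<open>N\<close> is now itself a maximal tight set around the uncoloured element, hence may replace
    \<open>M\<close> as the centre of the fan; no set meeting it can be heavy too.\<close>
  have st: "state \<pi> u N" using state_outer(1) Nil \<open>e = u\<close> by blast
  obtain f Nf where f: "(fan_step \<pi> N)\<^sup>*\<^sup>* u f"
    and Nf: "tight \<pi> Nf" "f \<in> Nf" "\<not> Nf \<subseteq> N" "int k < g Nf + int (max_crossing F Nf)"
    using reachable_outer_heavy[OF st] by blast
  show False
    using no_heavy_pair[OF stateD(3,4)[OF st] Nf(1) reachable_in[OF f stateD(5)[OF st]] Nf(2,3)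
        heavy Nf(4)] .
next
  case (Cons c0 cs)
  note st = Cons.prems(1)
  from Cons.prems(2) obtain v where v: "fan_step \<pi> M u v" "c0 = \<pi> v" "fan \<pi> M v e cs" "c0 \<notin> set cs"
    by (auto elim: fan_ConsE)
  show ?case
  proof (rule Cons.IH[OF shifted_state[OF st v(1)]])
    show "fan (shifted \<pi> u v) M v e cs" using fan_shifted[OF st v(1,3)] v by simp
    show "tight (shifted \<pi> u v) N"
      using shifted_outer[OF st v(1) fan_reachable[OF Cons.prems(2)] Cons.prems(3-5)] .
  qed (use Cons.prems in blast)+
qed

lemma no_state: "\<not> state \<pi> u M"
proof
  assume st: "state \<pi> u M"
  obtain e N where e: "(fan_step \<pi> M)\<^sup>*\<^sup>* u e"
    and N: "tight \<pi> N" "e \<in> N" "\<not> N \<subseteq> M" "int k < g N + int (max_crossing F N)"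
    using reachable_outer_heavy[OF st] by blast
  obtain cs where "fan \<pi> M u e cs" using fan_if_reachable[OF e] by blast
  then show False using no_heavy_outer[OF st _ N] by blast
qed

end

end

section \<open>Colouring the elements one at a time\<close>

theorem theorem1p9:
  fixes U :: "'a set" and F :: "'a set set" and g :: "'a set \<Rightarrow> int" and k :: nat
  assumes "finite U"
    and "F \<subseteq> Pow U"
    and "intersecting_two_thirds_laminar F"
    and "intersecting_two_thirds_supermodular F g"
    and "k > 0"
    and "g_laminar F g {X \<in> F. g X + int (max_crossing F X) > int k}"
    and "\<And>X. X \<in> F \<Longrightarrow> min (int (card X)) (int k) \<ge> g X"
  shows "\<exists>\<pi> :: 'a \<Rightarrow> nat. \<pi> \<in> U \<rightarrow> {1..k} \<and> (\<forall>X\<in>F. int (card (\<pi> ` X)) \<ge> g X)"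
proof -
  interpret two_thirds_supermodular U F g k
    using assms by unfold_locales auto
  have "\<exists>\<pi>. coloring \<pi> D \<and> valid \<pi>" if "D \<subseteq> U" for D
    using finite_subset[OF that assms(1)] that
  proof (induction D rule: finite_induct)
    case empty
    \<comment> \<open>With nothing coloured, a set has as many private colours as elements, so the
      bound of \<open>g X\<close> by \<open>card X\<close> suffices.\<close>
    have "valid (Inr :: 'a \<Rightarrow> nat + 'a)"
      using assms(7) by (auto simp: valid_def card_image)
    moreover have "coloring Inr {}" by (simp add: coloring_def)
    ultimately show ?case by blast
  next
    case (insert u D)
    then obtain \<pi> where \<pi>: "coloring \<pi> D" "valid \<pi>" by blast
    show ?case
    proof (rule ccontr)
      assume "\<nexists>\<pi>. coloring \<pi> (insert u D) \<and> valid \<pi>"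
      then interpret no_extension U F g k "insert u D"
        using insert.prems by unfold_locales auto
      have c: "coloring \<pi> (insert u D - {u})" using \<pi>(1) insert.hyps(2) by simp
      \<comment> \<open>Any colour serves: that it is blocked at \<open>u\<close> provides a tight
        set through \<open>u\<close>.\<close>
      have "Inl 1 \<in> colors" using assms(5) by simp
      then obtain X where "tight \<pi> X" "u \<in> X" using color_blocked[OF c _ \<pi>(2)] by blast
      then obtain M where "maxtight \<pi> M" "u \<in> M" using ex_maxtight by blast
      then have "state \<pi> u M" using c \<pi>(2) by (simp add: state_def)
      then show False using no_state[OF assms(6)] by blast
    qed
  qed
  then obtain \<pi> where \<pi>: "coloring \<pi> U" "valid \<pi>" by blast
  have col: "\<pi> x \<in> colors" if "x \<in> U" for x
    using \<pi>(1) that unfolding coloring_def by (metis (full_types))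
  have "projl \<circ> \<pi> \<in> U \<rightarrow> {1..k}" using col by fastforce
  moreover have "g X \<le> int (card ((projl \<circ> \<pi>) ` X))" if X: "X \<in> F" for X
  proof -
    \<comment> \<open>All of \<open>U\<close> is coloured, so no private colour is left on
      \<open>X\<close>, and removing the tag \<open>Inl\<close> preserves the number of
      colours.\<close>
    have "X \<subseteq> U" using X assms(2) by blast
    then have "\<pi> ` X \<subseteq> range Inl" using col by blast
    moreover have "inj_on projl (range (Inl :: nat \<Rightarrow> nat + 'a))" by (auto simp: inj_on_def)
    ultimately have "inj_on projl (\<pi> ` X)" by (meson inj_on_subset)
    then have "card ((projl \<circ> \<pi>) ` X) = card (\<pi> ` X)" unfolding image_comp[symmetric] by (rule card_image)
    then show ?thesis using \<pi>(2) X by (simp add: valid_def)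
  qed
  ultimately show ?thesis by blast
qed

end
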